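(* Define $F:\mathrm{SCH}\to\Lambda$ by $F_P=\mathrm{G}_P(\mathbf{x};q)$. Then: (i) $F_{\mathtt{n}\mathtt{d}^k\mathtt{e}}=\mathrm{e}_{k+1}$ for all integers $k\ge0$; (ii) $F_{PQ}=F_PF_Q$ for all $P,Q\in\mathrm{SCH}$; (iii) for all words $U,V\in\{\mathtt{n},\mathtt{d},\mathtt{e}\}^*$ with $U\mathtt{d}V\in\mathrm{SCH}$, $F_{U\mathtt{n}\mathtt{e}V}-F_{U\mathtt{e}\mathtt{n}V}=(q-1)F_{U\mathtt{d}V}$. Moreover, let $P\in\mathrm{SCH}$ and let $(x,z)\in\mathbb{Z}^2$ be a point on $P$ with $x+1<z$ such that the bounce decomposition of $P$ at $(x,z)$ is $P=Us\cdot tV\mathtt{d}\cdot\mathtt{e}W$ for some $st\in\{\mathtt{n}\mathtt{n},\mathtt{d}\mathtt{n},\mathtt{n}\mathtt{d}\}$. Then $F_P=qF_{U\mathtt{n}\mathtt{n}V\mathtt{e}\mathtt{d}W}$ if $st=\mathtt{n}\mathtt{n}$; $F_P=F_{U\mathtt{n}\mathtt{d}V\mathtt{e}\mathtt{d}W}$ if $st=\mathtt{d}\mathtt{n}$; $F_P=(q-1)F_{U\mathtt{n}\mathtt{d}V\mathtt{e}\mathtt{d}W}+qF_{U\mathtt{d}\mathtt{n}V\mathtt{e}\mathtt{d}W}$ if $st=\mathtt{n}\mathtt{d}$.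
   Context: Let $K=\mathbb{Q}(q)$ and $\Lambda$ the algebra of symmetric functions over $K$ in $\mathbf{x}=(x_1,x_2,\dots)$; $\mathrm{e}_k$ are elementary symmetric functions. Steps: $\mathtt{n}=(0,1)$, $\mathtt{e}=(1,0)$, $\mathtt{d}=(1,1)$. A Schröder path of size $n$ is a lattice path from $(0,0)$ to $(n,n)$ with steps in $\{\mathtt{n},\mathtt{e},\mathtt{d}\}$ such that every east and every diagonal step is preceded by strictly more north steps than east steps. Paths are words in $\{\mathtt{n},\mathtt{d},\mathtt{e}\}^*$, $PQ$ is concatenation, $\mathrm{SCH}$ is the set of all Schröder paths. Bounce path of $P$ (size $n$) at a lattice point $(u_1,u_0)$ on $P$: move south from $(u_1,u_0)$ to $(u_1,u_1)$, then west until first reaching a point $(u_2,u_1)$ of $P$; if that point lies between two diagonal steps of $P$, continue south to $(u_2,u_2)$ and west to a point $(u_3,u_2)$ of $P$, and so on, stopping at the first point $(u_{k+1},u_k)$ incident to a north or east step of $P$. The points $(u_i,u_i)$, $1\le i\le k$, are the bounce points. The bounce decomposition at $(u_1,u_0)$ is the unique factorisation $P=Us_1\cdot s_2Vs_3\cdot s_4W$ ($s_i$ single steps, $U,V,W$ words) where $Us_1$ is the part of $P$ from $(0,0)$ to $(u_{k+1},u_k)$ and $s_4W$ is the part from $(u_1,u_0)$ to $(n,n)$; dots are only markers. For $P$ of size $n$, $\Gamma_P$ is the graph on $[n]$ where, for $1\le x<y\le n$, $\{x,y\}$ is a non-strict edge if the unit square $[x-1,x]\times[y-1,y]$ lies in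 the region between $P$ and the line $y=x$, and $\{x,y\}$ is a strict edge if $P$ has a diagonal step from $(x-1,y-1)$ to $(x,y)$. A coloring is a map $\kappa:[n]\to\mathbb{Z}_{>0}$ with $\kappa(x)<\kappa(y)$ for each strict edge $\{x,y\}$, $x<y$; $\mathrm{asc}(\kappa)$ is the number of non-strict edges $\{x,y\}$, $x<y$, with $\kappa(x)<\kappa(y)$. The vertical-strip LLT polynomial is $\mathrm{G}_P(\mathbf{x};q)=\sum_\kappa q^{\mathrm{asc}(\kappa)}x_{\kappa(1)}\cdots x_{\kappa(n)}$, summed over all colorings of $\Gamma_P$. *)

theory Defs
  imports
    "HOL-Analysis.Analysis"
    "HOL-Library.Multiset"
    "HOL-Library.FuncSet"
    "HOL-Combinatorics.Permutations"
    "HOL-Computational_Algebra.Polynomial"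
    "HOL-Computational_Algebra.Fraction_Field"
begin

section \<open>Symmetric functions over \<open>\<rat>(q)\<close>\<close>

type_synonym K = "rat poly fract"

definition q :: K where
  "q = Fract [:0, 1:] 1"

text \<open>
  Formal power series in infinitely many commuting variables \<open>x\<^sub>i\<close>. The monomial
  \<open>x\<^bsub>i\<^sub>1\<^esub> \<cdots> x\<^bsub>i\<^sub>d\<^esub>\<close> is represented by the multiset \<open>{#i\<^sub>1, \<dots>, i\<^sub>d#}\<close> of its
  indices, and a series is given by its coefficients.
\<close>

typedef 'a mps = "UNIV :: (nat multiset \<Rightarrow> 'a) set"
  morphisms coeff_mps Abs_mps
  by simp

lemma coeff_Abs_mps [simp]: "coeff_mps (Abs_mps f) = f"
  by (simp add: Abs_mps_inverse)

lemma mps_eqI: "(\<And>M. coeff_mps f M = coeff_mps g M) \<Longrightarrow> f = g"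
  by (metis coeff_mps_inject ext)

lemma finite_mset_splits: "finite {(A, B). A + B = (M :: 'b multiset)}"
proof -
  have "finite {A. A \<subseteq># M}"
  proof (induction M)
    case (add x M)
    have "A \<in> {A. A \<subseteq># M} \<union> add_mset x ` {A. A \<subseteq># M}" if "A \<subseteq># add_mset x M" for A
    proof (cases "x \<in># A")
      case True
      then obtain B where "A = add_mset x B"
        by (metis insert_DiffM)
      with that show ?thesis
        by auto
    next
      case False
      with that have "A \<subseteq># M"
        by (metis diff_single_trivial add_mset_remove_trivial subset_eq_diff_conv add_mset_add_single)
      then show ?thesis
        by simp
    qed
    then have "{A. A \<subseteq># add_mset x M} \<subseteq> {A. A \<subseteq># M} \<union> add_mset x ` {A. A \<subseteq># M}"
      by blast
    with add.IH show ?case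
      by (meson finite_UnI finite_imageI finite_subset)
  qed simp
  moreover have "{(A, B). A + B = M} \<subseteq> (\<lambda>A. (A, M - A)) ` {A. A \<subseteq># M}"
    by auto
  ultimately show ?thesis
    by (meson finite_imageI finite_subset)
qed

instantiation mps :: (comm_ring_1) comm_ring_1
begin

definition zero_mps :: "'a mps" where
  "0 = Abs_mps (\<lambda>M. 0)"

definition one_mps :: "'a mps" where
  "1 = Abs_mps (\<lambda>M. if M = {#} then 1 else 0)"

definition plus_mps :: "'a mps \<Rightarrow> 'a mps \<Rightarrow> 'a mps" where
  "f + g = Abs_mps (\<lambda>M. coeff_mps f M + coeff_mps g M)"

definition uminus_mps :: "'a mps \<Rightarrow> 'a mps" where
  "- f = Abs_mps (\<lambda>M. - coeff_mps f M)"

definition minus_mps :: "'a mps \<Rightarrow> 'a mps \<Rightarrow> 'a mps" where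
  "f - g = Abs_mps (\<lambda>M. coeff_mps f M - coeff_mps g M)"

definition times_mps :: "'a mps \<Rightarrow> 'a mps \<Rightarrow> 'a mps" where
  "f * g = Abs_mps (\<lambda>M. \<Sum>(A, B) \<in> {(A, B). A + B = M}. coeff_mps f A * coeff_mps g B)"

instance
proof
  fix f g h :: "'a mps"
  show "f + g + h = f + (g + h)" "f + g = g + f" "0 + f = f" "- f + f = 0" "f - g = f + - g"
    by (rule mps_eqI; simp add: plus_mps_def zero_mps_def uminus_mps_def minus_mps_def
        algebra_simps)+
  show "(f + g) * h = f * h + g * h"
    by (rule mps_eqI)
      (simp add: plus_mps_def times_mps_def algebra_simps sum.distrib case_prod_unfold)
  show "f * g = g * f"
    by (rule mps_eqI, simp add: times_mps_def,
        rule sum.reindex_bij_witness[of _ prod.swap prod.swap])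
      (auto simp: algebra_simps)
  show "1 * f = f"
  proof (rule mps_eqI)
    fix M
    have "coeff_mps (1 * f) M =
        (\<Sum>p \<in> {(A, B). A + B = M}. if p = ({#}, M) then coeff_mps f M else 0)"
      by (auto simp: times_mps_def one_mps_def intro!: sum.cong)
    also have "\<dots> = coeff_mps f M"
      by (subst sum.delta) (auto simp: finite_mset_splits)
    finally show "coeff_mps (1 * f) M = coeff_mps f M" .
  qed
  show "f * g * h = f * (g * h)"
  proof (rule mps_eqI)
    fix M
    let ?S = "\<lambda>M. {(A, B). A + B = (M :: nat multiset)}"
    have "coeff_mps (f * g * h) M =
        (\<Sum>p \<in> ?S M. \<Sum>r \<in> ?S (fst p).
          coeff_mps f (fst r) * coeff_mps g (snd r) * coeff_mps h (snd p))"
      by (simp add: times_mps_def case_prod_unfold sum_distrib_right)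
    also have "\<dots> = (\<Sum>(p, r) \<in> (SIGMA p:?S M. ?S (fst p)).
          coeff_mps f (fst r) * coeff_mps g (snd r) * coeff_mps h (snd p))"
      by (subst sum.Sigma) (use finite_mset_splits in \<open>auto\<close>)
    also have "\<dots> = (\<Sum>(p, r) \<in> (SIGMA p:?S M. ?S (snd p)).
          coeff_mps f (fst p) * (coeff_mps g (fst r) * coeff_mps h (snd r)))"
      by (rule sum.reindex_bij_witness
          [of _ "\<lambda>((A, B), (C, D)). ((A + C, D), (A, C))" "\<lambda>((A, B), (C, D)). ((C, D + B), (D, B))"])
        (auto simp: algebra_simps)
    also have "\<dots> = (\<Sum>p \<in> ?S M. \<Sum>r \<in> ?S (snd p).
          coeff_mps f (fst p) * (coeff_mps g (fst r) * coeff_mps h (snd r)))"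
      by (subst sum.Sigma) (use finite_mset_splits in \<open>auto\<close>)
    also have "\<dots> = coeff_mps (f * (g * h)) M"
      by (simp add: times_mps_def case_prod_unfold sum_distrib_left)
    finally show "coeff_mps (f * g * h) M = coeff_mps (f * (g * h)) M" .
  qed
  have "coeff_mps (0 :: 'a mps) {#} \<noteq> coeff_mps 1 {#}"
    by (simp add: zero_mps_def one_mps_def)
  then show "(0 :: 'a mps) \<noteq> 1"
    by metis
qed

end

definition scale_mps :: "'a::comm_ring_1 \<Rightarrow> 'a mps \<Rightarrow> 'a mps" where
  "scale_mps c f = Abs_mps (\<lambda>M. c * coeff_mps f M)"

text \<open>
  The variables of \<open>\<Lambda>\<close> are \<open>x\<^sub>1, x\<^sub>2, \<dots>\<close>, so the index \<open>0\<close>, which the type \<^typ>\<open>'a mps\<close>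
  allows, must not occur.
\<close>

definition Lambda :: "K mps set" where
  "Lambda = {f.
     (\<forall>M. coeff_mps f M \<noteq> 0 \<longrightarrow> set_mset M \<subseteq> {0<..}) \<and>
     (\<exists>d. \<forall>M. coeff_mps f M \<noteq> 0 \<longrightarrow> size M \<le> d) \<and>
     (\<forall>\<sigma> M. \<sigma> permutes {0<..} \<longrightarrow> coeff_mps f (image_mset \<sigma> M) = coeff_mps f M)}"

definition elem_sym :: "nat \<Rightarrow> K mps" where
  "elem_sym k = Abs_mps (\<lambda>M.
     if \<exists>S. S \<subseteq> {0<..} \<and> finite S \<and> card S = k \<and> M = mset_set S then 1 else 0)"


section \<open>Schroeder paths\<close>

datatype step = N | D | E

text \<open>The lattice point reached from \<open>(0, 0)\<close> by a word.\<close>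

definition endpt :: "step list \<Rightarrow> nat \<times> nat" where
  "endpt w = (count_list w E + count_list w D, count_list w N + count_list w D)"

definition schroeder :: "nat \<Rightarrow> step list \<Rightarrow> bool" where
  "schroeder n P \<longleftrightarrow> endpt P = (n, n) \<and>
     (\<forall>A s B. P = A @ [s] @ B \<and> s \<in> {E, D} \<longrightarrow> count_list A E < count_list A N)"

definition SCH :: "step list set" where
  "SCH = {P. \<exists>n. schroeder n P}"

text \<open>
  The size of a path, i.e. the common value of the two coordinates of its endpoint.
\<close>

definition psize :: "step list \<Rightarrow> nat" where
  "psize P = fst (endpt P)"


section \<open>Bounce decompositions\<close>

text \<open>
  A step meets the integer lattice, and a diagonal step meets the horizontal lines of integer
  height, only in its two endpoints. So the lattice points on a path are the endpoints of its
  prefixes, and travelling along such a line one meets the path only in these points.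
\<close>

definition on_path :: "step list \<Rightarrow> nat \<times> nat \<Rightarrow> bool" where
  "on_path P p \<longleftrightarrow> (\<exists>A B. P = A @ B \<and> endpt A = p)"

definition first_west :: "step list \<Rightarrow> nat \<Rightarrow> nat \<Rightarrow> bool" where
  "first_west P u v \<longleftrightarrow>
     v \<le> u \<and> on_path P (v, u) \<and> (\<forall>v'. v < v' \<and> v' \<le> u \<longrightarrow> \<not> on_path P (v', u))"

definition between_diagonals :: "step list \<Rightarrow> nat \<times> nat \<Rightarrow> bool" where
  "between_diagonals P p \<longleftrightarrow> (\<exists>A B. P = A @ [D] @ [D] @ B \<and> endpt (A @ [D]) = p)"

definition incident_NE :: "step list \<Rightarrow> nat \<times> nat \<Rightarrow> bool" where
  "incident_NE P p \<longleftrightarrow>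
     (\<exists>A s B. P = A @ [s] @ B \<and> s \<in> {N, E} \<and> (endpt A = p \<or> endpt (A @ [s]) = p))"

text \<open>
  \<open>bounce P (u\<^sub>1, u\<^sub>0) (u\<^bsub>k+1\<^esub>, u\<^sub>k)\<close>: the bounce path of \<open>P\<close> at \<open>(u\<^sub>1, u\<^sub>0)\<close> stops at
  \<open>(u\<^bsub>k+1\<^esub>, u\<^sub>k)\<close>. The stopping condition is not tested at the starting point, hence \<open>k \<ge> 1\<close>.
\<close>

inductive bounce :: "step list \<Rightarrow> nat \<times> nat \<Rightarrow> nat \<times> nat \<Rightarrow> bool" for P where
  stop: "first_west P u1 u2 \<Longrightarrow> incident_NE P (u2, u1) \<Longrightarrow> bounce P (u1, u0) (u2, u1)"
| bounce_on: "first_west P u1 u2 \<Longrightarrow> between_diagonals P (u2, u1) \<Longrightarrow> bounce P (u2, u1) p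
    \<Longrightarrow> bounce P (u1, u0) p"

text \<open>
  The bounce decomposition of \<open>P\<close> at the point \<open>p\<close> is \<open>P = U s\<^sub>1 \<cdot> s\<^sub>2 V s\<^sub>3 \<cdot> s\<^sub>4 W\<close>.
\<close>

definition bounce_decomp ::
    "step list \<Rightarrow> nat \<times> nat \<Rightarrow> step list \<Rightarrow> step \<Rightarrow> step \<Rightarrow> step list \<Rightarrow> step \<Rightarrow> step \<Rightarrow> step list \<Rightarrow> bool"
  where
  "bounce_decomp P p U s1 s2 V s3 s4 W \<longleftrightarrow>
     P = U @ [s1] @ [s2] @ V @ [s3] @ [s4] @ W \<and>
     endpt (U @ [s1] @ [s2] @ V @ [s3]) = p \<and>
     bounce P p (endpt (U @ [s1]))"


section \<open>Vertical-strip LLT polynomials\<close>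

definition real_pt :: "nat \<times> nat \<Rightarrow> real \<times> real" where
  "real_pt p = (real (fst p), real (snd p))"

definition curve :: "step list \<Rightarrow> (real \<times> real) set" where
  "curve P = \<Union> {closed_segment (real_pt (endpt A)) (real_pt (endpt (A @ [s]))) | A s B.
     P = A @ [s] @ B}"

text \<open>The region between the path and the line \<open>y = x\<close>; a Schroeder path lies above that line.\<close>

definition region :: "step list \<Rightarrow> (real \<times> real) set" where
  "region P = {(a, b). a \<le> b \<and> (\<exists>c. b \<le> c \<and> (a, c) \<in> curve P)}"

definition nonstrict_edges :: "step list \<Rightarrow> (nat \<times> nat) set" where
  "nonstrict_edges P = {(x, y). 1 \<le> x \<and> x < y \<and> y \<le> psize P \<and>
     {real x - 1..real x} \<times> {real y - 1..real y} \<subseteq> region P}"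

definition strict_edges :: "step list \<Rightarrow> (nat \<times> nat) set" where
  "strict_edges P = {(x, y). 1 \<le> x \<and> x < y \<and> y \<le> psize P \<and>
     (\<exists>A B. P = A @ [D] @ B \<and> endpt A = (x - 1, y - 1) \<and> endpt (A @ [D]) = (x, y))}"

definition colorings :: "step list \<Rightarrow> (nat \<Rightarrow> nat) set" where
  "colorings P = {\<kappa> \<in> {1..psize P} \<rightarrow>\<^sub>E {0<..}. \<forall>(x, y) \<in> strict_edges P. \<kappa> x < \<kappa> y}"

definition asc :: "step list \<Rightarrow> (nat \<Rightarrow> nat) \<Rightarrow> nat" where
  "asc P \<kappa> = card {(x, y) \<in> nonstrict_edges P. \<kappa> x < \<kappa> y}"

text \<open>
  The coefficient of a monomial collects the colorings \<open>\<kappa>\<close> with \<open>x\<^bsub>\<kappa>(1)\<^esub> \<cdots> x\<^bsub>\<kappa>(n)\<^esub>\<close> equal to it.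
  These are finitely many.
\<close>

definition LLT :: "step list \<Rightarrow> K mps" where
  "LLT P = Abs_mps (\<lambda>M.
     \<Sum>\<kappa> \<in> {\<kappa> \<in> colorings P. image_mset \<kappa> (mset_set {1..psize P}) = M}. q ^ asc P \<kappa>)"

end

(*
  The weight of a coloring is a product over the columns crossed by the path, which makes the first
  three relations identities between weights or bijections between sets of colorings.

  For the bounce relations, let (u_(i+1), u_i) be the points at which the bounce path meets P. The
  pairs of consecutive vertices a_i = u_i and b_i = u_i + 1 have the same neighbours, up to the
  strict edges from a_(i+1) to a_i and from b_(i+1) to b_i, the nonstrict edge from b_(i+1) to a_i
  and the edges at the two ends of the bounce path. So one may sum over the ways to exchange the
  colors of a_i and b_i for each i, and the relation between the weights that holds at the bottom
  end propagates along the bounce path from pair to pair until it meets the top end.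

  For the symmetry, the relations rewrite a path at its first east step, which is moved to the left
  or removed, until the path splits off a factor n d^k e. So every LLT polynomial is a polynomial in
  the elementary symmetric functions.
*)

theory Submission
  imports Defs
begin

section \<open>Words and lattice points\<close>

text \<open>The relation carried along the bounce path is the action of a Hecke operator
  \<open>T\<close> on the colours of a pair \<open>a\<close>, \<open>a + 1\<close>. On the values of
  a function before and after the exchange, the smaller colour being on \<open>a\<close> before it,
  \<open>T\<close> has the rows \<open>(q - 1, 1)\<close> and \<open>(q, 0)\<close>; on equal
  colours it is multiplication by \<open>q\<close>. So \<open>T^2 = (q - 1) T + q\<close>. A prefix
  weight \<open>h\<close> symmetric in the pair satisfies \<open>T h = q h\<close>; at the bottom,
  the prefix through \<open>[N, D]\<close> is \<open>T\<close> applied to the one through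
  \<open>[D, N]\<close>; one more \<open>T\<close> gives the combination with coefficients
  \<open>q - 1\<close> and \<open>q\<close>. The three bounce relations are thus one statement:
  replacing \<open>[D, E]\<close> by \<open>[E, D]\<close> at the top amounts to applying
  \<open>T\<close> to the prefix weight. The obstacle is that a prefix weight does not stay the
  weight of a word: behind a bounce point it is a sum over both distributions of colours on the
  lower pair. Hence suffixes are compared against all pairs of functions related by
  \<open>T\<close>.\<close>

lemma endpt_Nil [simp]: "endpt [] = (0, 0)"
  by (simp add: endpt_def)

lemma endpt_Cons [simp]:
  "endpt (N # w) = (fst (endpt w), Suc (snd (endpt w)))"
  "endpt (E # w) = (Suc (fst (endpt w)), snd (endpt w))"
  "endpt (D # w) = (Suc (fst (endpt w)), Suc (snd (endpt w)))"
  by (auto simp: endpt_def)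

lemma endpt_append [simp]:
  "endpt (v @ w) = (fst (endpt v) + fst (endpt w), snd (endpt v) + snd (endpt w))"
  by (auto simp: endpt_def)

text \<open>The Schroeder condition for a word entered at height \<open>k\<close> above the
  diagonal, in a recursive form that splits over concatenation. Integers are used because factors of
  a path may have negative excess.\<close>

fun stays_above :: "int \<Rightarrow> step list \<Rightarrow> bool" where
  "stays_above k [] = True"
| "stays_above k (N # w) = stays_above (k + 1) w"
| "stays_above k (D # w) = (k > 0 \<and> stays_above k w)"
| "stays_above k (E # w) = (k > 0 \<and> stays_above (k - 1) w)"

definition excess :: "step list \<Rightarrow> int" where
  "excess w = int (snd (endpt w)) - int (fst (endpt w))"

lemma excess_simps [simp]:
  "excess [] = 0" "excess (N # w) = excess w + 1" "excess (D # w) = excess w"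
  "excess (E # w) = excess w - 1" "excess (v @ w) = excess v + excess w"
  by (auto simp: excess_def)

lemma stays_above_append [simp]: "stays_above k (v @ w) \<longleftrightarrow> stays_above k v \<and> stays_above (k + excess v) w"
  by (induction k v rule: stays_above.induct) (auto simp: algebra_simps)

lemma stays_above_excess: "stays_above k w \<Longrightarrow> 0 \<le> k \<Longrightarrow> 0 \<le> k + excess w"
  by (induction k w rule: stays_above.induct) (auto simp: algebra_simps)

lemma excess_count: "excess w = int (count_list w N) - int (count_list w E)"
  by (simp add: excess_def endpt_def)

text \<open>Hiding the remainder of the word lets a single rule for \<open>Cons\<close>,
  \<open>ex_occurs_Cons\<close>, serve the inductions for both kinds of edges and for the Schroeder
  condition, which is negated to become existential too.\<close>

definition occurs :: "step list \<Rightarrow> step list \<Rightarrow> step \<Rightarrow> bool" where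
  "occurs w A s \<longleftrightarrow> (\<exists>B. w = A @ [s] @ B)"

lemma ex_occurs_Cons:
  "(\<exists>A s. occurs (x # w) A s \<and> R A s) \<longleftrightarrow> R [] x \<or> (\<exists>A s. occurs w A s \<and> R (x # A) s)"
  by (auto simp: occurs_def Cons_eq_append_conv)

lemma not_stays_above_iff:
  "\<not> stays_above k P \<longleftrightarrow> (\<exists>A s. occurs P A s \<and> s \<in> {E, D} \<and> k + excess A \<le> 0)"
proof (induction k P rule: stays_above.induct)
  case (1 k)
  show ?case by (simp add: occurs_def)
qed (simp_all only: ex_occurs_Cons, auto simp: algebra_simps)

lemma schroeder_iff: "schroeder n P \<longleftrightarrow> endpt P = (n, n) \<and> stays_above 0 P"
proof -
  have "stays_above 0 P \<longleftrightarrow> \<not> (\<exists>A s. occurs P A s \<and> s \<in> {E, D} \<and> 0 + excess A \<le> 0)"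
    unfolding not_stays_above_iff[symmetric] by simp
  also have "\<dots> \<longleftrightarrow> (\<forall>A s B. P = A @ [s] @ B \<and> s \<in> {E, D} \<longrightarrow> count_list A E < count_list A N)"
    unfolding occurs_def excess_count by (simp add: not_le) blast
  finally show ?thesis
    unfolding schroeder_def by blast
qed

lemma SCH_iff: "P \<in> SCH \<longleftrightarrow> excess P = 0 \<and> stays_above 0 P"
  by (auto simp: SCH_def schroeder_iff excess_def prod_eq_iff)

lemma endpt_SCH: "P \<in> SCH \<Longrightarrow> endpt P = (psize P, psize P)"
  by (auto simp: SCH_iff excess_def psize_def prod_eq_iff)

section \<open>Weights of words\<close>

definition ascent :: "nat \<Rightarrow> nat \<Rightarrow> K" where
  "ascent a b = (if a < b then q else 1)"

definition strict :: "nat \<Rightarrow> nat \<Rightarrow> K" where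
  "strict a b = (if a < b then 1 else 0)"

text \<open>
  The edges of the graph of a path are grouped by their smaller vertex \<open>x\<close> and accounted for when
  the path crosses the \<open>x\<close>-th column. The word \<open>w\<close> starts at the point \<open>(i, j)\<close>.
\<close>

fun wt :: "step list \<Rightarrow> nat \<Rightarrow> nat \<Rightarrow> (nat \<Rightarrow> nat) \<Rightarrow> K" where
  "wt [] i j \<kappa> = 1"
| "wt (N # w) i j \<kappa> = wt w i (Suc j) \<kappa>"
| "wt (E # w) i j \<kappa> =
     (\<Prod>y \<in> {Suc (Suc i)..j}. ascent (\<kappa> (Suc i)) (\<kappa> y)) * wt w (Suc i) j \<kappa>"
| "wt (D # w) i j \<kappa> =
     (\<Prod>y \<in> {Suc (Suc i)..j}. ascent (\<kappa> (Suc i)) (\<kappa> y)) *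
     strict (\<kappa> (Suc i)) (\<kappa> (Suc j)) * wt w (Suc i) (Suc j) \<kappa>"

lemma wt_append:
  "wt (v @ w) i j \<kappa> = wt v i j \<kappa> * wt w (i + fst (endpt v)) (j + snd (endpt v)) \<kappa>"
  by (induction v i j \<kappa> rule: wt.induct) (auto simp: mult.assoc)

section \<open>Unit squares under the path and the edges of the graph\<close>

fun column_cells :: "step list \<Rightarrow> nat \<Rightarrow> nat \<Rightarrow> (nat \<times> nat) set" where
  "column_cells [] i j = {}"
| "column_cells (N # w) i j = column_cells w i (Suc j)"
| "column_cells (E # w) i j = {Suc i} \<times> {Suc (Suc i)..j} \<union> column_cells w (Suc i) j"
| "column_cells (D # w) i j = {Suc i} \<times> {Suc (Suc i)..j} \<union> column_cells w (Suc i) (Suc j)"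

fun diagonal_cells :: "step list \<Rightarrow> nat \<Rightarrow> nat \<Rightarrow> (nat \<times> nat) set" where
  "diagonal_cells [] i j = {}"
| "diagonal_cells (N # w) i j = diagonal_cells w i (Suc j)"
| "diagonal_cells (E # w) i j = diagonal_cells w (Suc i) j"
| "diagonal_cells (D # w) i j = insert (Suc i, Suc j) (diagonal_cells w (Suc i) (Suc j))"

lemma finite_column_cells: "finite (column_cells w i j)"
  by (induction w i j rule: column_cells.induct) auto

lemma column_cells_gt: "(x, y) \<in> column_cells w i j \<Longrightarrow> i < x"
  by (induction w i j rule: column_cells.induct) auto

lemma mem_column_cells:
  "(x, y) \<in> column_cells w i j \<longleftrightarrow> (\<exists>A s. occurs w A s \<and> s \<in> {E, D} \<and>
     x = Suc (i + fst (endpt A)) \<and> x < y \<and> y \<le> j + snd (endpt A))"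
proof (induction w i j rule: column_cells.induct)
  case (1 i j)
  show ?case by (simp add: occurs_def)
qed (simp_all only: ex_occurs_Cons column_cells.simps Un_iff, auto)

lemma mem_diagonal_cells:
  "(x, y) \<in> diagonal_cells w i j \<longleftrightarrow> (\<exists>A s. occurs w A s \<and> s = D \<and>
     x = Suc (i + fst (endpt A)) \<and> y = Suc (j + snd (endpt A)))"
proof (induction w i j rule: diagonal_cells.induct)
  case (1 i j)
  show ?case by (simp add: occurs_def)
qed (simp_all only: ex_occurs_Cons diagonal_cells.simps insert_iff, auto)

lemma prod_ascent: "finite Y \<Longrightarrow> (\<Prod>y\<in>Y. ascent a (f y)) = q ^ card {y \<in> Y. a < f y}"
  by (simp add: ascent_def prod.If_cases Int_def)

text \<open>Cells of later columns have a larger first coordinate, so the two sets are disjoint and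
  the exponents add.\<close>

lemma wt_column_step:
  "(\<Prod>y \<in> {Suc (Suc i)..j}. ascent (\<kappa> (Suc i)) (\<kappa> y)) *
     q ^ card {(x, y) \<in> column_cells w (Suc i) j'. \<kappa> x < \<kappa> y} =
   q ^ card {(x, y) \<in> {Suc i} \<times> {Suc (Suc i)..j} \<union> column_cells w (Suc i) j'. \<kappa> x < \<kappa> y}"
proof -
  let ?A = "{(x, y) \<in> {Suc i} \<times> {Suc (Suc i)..j}. \<kappa> x < \<kappa> y}"
  let ?B = "{(x, y) \<in> column_cells w (Suc i) j'. \<kappa> x < \<kappa> y}"
  have "?A = Pair (Suc i) ` {y \<in> {Suc (Suc i)..j}. \<kappa> (Suc i) < \<kappa> y}"
    by auto
  then have "card ?A = card {y \<in> {Suc (Suc i)..j}. \<kappa> (Suc i) < \<kappa> y}"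
    by (simp add: card_image inj_on_def)
  moreover have "finite ?A"
    by (rule finite_subset[of _ "{Suc i} \<times> {Suc (Suc i)..j}"]) auto
  moreover have "finite ?B"
    by (rule finite_subset[OF _ finite_column_cells[of w "Suc i" j']]) auto
  moreover have "?A \<inter> ?B = {}"
    using column_cells_gt[of _ _ w "Suc i" j'] by fastforce
  moreover have "{(x, y) \<in> {Suc i} \<times> {Suc (Suc i)..j} \<union> column_cells w (Suc i) j'. \<kappa> x < \<kappa> y}
      = ?A \<union> ?B"
    by auto
  ultimately show ?thesis
    by (simp add: prod_ascent card_Un_disjoint power_add)
qed

lemma wt_eq_power:
  "wt w i j \<kappa> = (if \<forall>(x, y) \<in> diagonal_cells w i j. \<kappa> x < \<kappa> y
     then q ^ card {(x, y) \<in> column_cells w i j. \<kappa> x < \<kappa> y} else 0)"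
proof (induction w i j \<kappa> rule: wt.induct)
  case (3 w i j \<kappa>)
  then show ?case
    using wt_column_step[of \<kappa> i j w j] by auto
next
  case (4 w i j \<kappa>)
  then show ?case
    using wt_column_step[of \<kappa> i j w "Suc j"] by (auto simp: strict_def)
qed auto

text \<open>A north step lies on a vertical lattice line, so the open column can only be crossed by
  an east or a diagonal step. The bound on \<open>c\<close> is an equality for \<open>D\<close> and
  slack for \<open>E\<close>.\<close>

lemma closed_segment_step_fst:
  assumes "(a, c) \<in> closed_segment (real_pt (endpt A)) (real_pt (endpt (A @ [s])))"
    and "real x - 1 < a" "a < real x"
  shows "s \<in> {E, D} \<and> x = Suc (fst (endpt A)) \<and> c - real (snd (endpt A)) \<le> a - (real x - 1)"
proof -
  from assms(1) obtain u where u: "0 \<le> u" "u \<le> 1"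
    and a: "a = (1 - u) * real (fst (endpt A)) + u * real (fst (endpt (A @ [s])))"
    and c: "c = (1 - u) * real (snd (endpt A)) + u * real (snd (endpt (A @ [s])))"
    by (auto simp: closed_segment_def real_pt_def)
  let ?f = "fst (endpt A)"
  show ?thesis
  proof (cases s)
    case N
    then have "a = real ?f"
      using a by (simp add: algebra_simps)
    with assms(2,3) have "real x < real (Suc ?f)" "real ?f < real x"
      by linarith+
    then show ?thesis
      unfolding of_nat_less_iff by simp
  next
    case D
    then have "a = real ?f + u" "c = real (snd (endpt A)) + u"
      using a c by (auto simp: algebra_simps)
    moreover from this have "real x < real (?f + 2)" "real ?f < real x"
      using assms(2,3) u by linarith+
    then have "x = Suc ?f"
      unfolding of_nat_less_iff by simp
    ultimately show ?thesis
      using D by auto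
  next
    case E
    then have "a = real ?f + u" "c = real (snd (endpt A))"
      using a c by (auto simp: algebra_simps)
    moreover from this have "real x < real (?f + 2)" "real ?f < real x"
      using assms(2,3) u by linarith+
    then have "x = Suc ?f"
      unfolding of_nat_less_iff by simp
    ultimately show ?thesis
      using E assms(2) by auto
  qed
qed

lemma square_subset_region_iff:
  assumes "1 \<le> x" "x < y"
  shows "{real x - 1..real x} \<times> {real y - 1..real y} \<subseteq> region P \<longleftrightarrow>
    (x, y) \<in> column_cells P 0 0"
proof
  assume sub: "{real x - 1..real x} \<times> {real y - 1..real y} \<subseteq> region P"
  \<comment> \<open>Above the midpoint of the top side, the path is at most \<open>1/2\<close>
    higher than the start of its step, so by integrality that start already has height at least
    \<open>y\<close>.\<close>
  have "(real x - 1/2, real y) \<in> region P"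
    by (rule subsetD[OF sub]) auto
  then obtain c A s B where c: "real y \<le> c" and P: "P = A @ [s] @ B"
    and seg: "(real x - 1/2, c) \<in> closed_segment (real_pt (endpt A)) (real_pt (endpt (A @ [s])))"
    unfolding region_def curve_def by blast
  have *: "s \<in> {E, D}" "x = Suc (fst (endpt A))" "c - real (snd (endpt A)) \<le> 1/2"
    using closed_segment_step_fst[OF seg, of x] by auto
  with c have "y \<le> snd (endpt A)"
    by linarith
  with * P assms show "(x, y) \<in> column_cells P 0 0"
    by (auto simp: mem_column_cells occurs_def)
next
  assume "(x, y) \<in> column_cells P 0 0"
  then obtain A s B where P: "P = A @ [s] @ B" and s: "s \<in> {E, D}"
    and x: "x = Suc (fst (endpt A))" and y: "y \<le> snd (endpt A)"
    by (auto simp: mem_column_cells occurs_def)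
  show "{real x - 1..real x} \<times> {real y - 1..real y} \<subseteq> region P"
  proof clarify
    fix a b
    assume a: "a \<in> {real x - 1..real x}" and b: "b \<in> {real y - 1..real y}"
    \<comment> \<open>\<open>?u\<close> is the part of the column already crossed at
      \<open>a\<close>, and \<open>?c\<close> the height of the step there.\<close>
    let ?u = "a - (real x - 1)"
    let ?c = "real (snd (endpt A)) + (if s = D then ?u else 0)"
    have "(a, ?c) \<in> closed_segment (real_pt (endpt A)) (real_pt (endpt (A @ [s])))"
      unfolding closed_segment_def using a s x
      by (auto simp: real_pt_def algebra_simps intro!: exI[of _ ?u])
    then have "(a, ?c) \<in> curve P"
      unfolding curve_def using P by blast
    moreover have "b \<le> ?c"
      using a b y by auto
    moreover have "a \<le> b"
      using a b assms by (auto simp: nat_less_real_le)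
    ultimately show "(a, b) \<in> region P"
      unfolding region_def by blast
  qed
qed

lemma nonstrict_edges_eq:
  assumes "P \<in> SCH"
  shows "nonstrict_edges P = column_cells P 0 0"
proof -
  have "1 \<le> x \<and> x < y \<and> y \<le> psize P" if "(x, y) \<in> column_cells P 0 0" for x y
  proof -
    from that obtain A s B where "P = A @ [s] @ B"
      and "x = Suc (fst (endpt A))" "x < y" "y \<le> snd (endpt A)"
      by (auto simp: mem_column_cells occurs_def)
    with endpt_SCH[OF assms] show ?thesis
      by auto
  qed
  then show ?thesis
    unfolding nonstrict_edges_def using square_subset_region_iff[of _ _ P] by blast
qed

lemma strict_edges_eq:
  assumes "P \<in> SCH"
  shows "strict_edges P = diagonal_cells P 0 0"
proof (rule set_eqI, clarify)
  fix x y
  show "(x, y) \<in> strict_edges P \<longleftrightarrow> (x, y) \<in> diagonal_cells P 0 0"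
  proof
    assume "(x, y) \<in> diagonal_cells P 0 0"
    then obtain A B where P: "P = A @ [D] @ B" and x: "x = Suc (fst (endpt A))"
      and y: "y = Suc (snd (endpt A))"
      by (auto simp: mem_diagonal_cells occurs_def)
    have "stays_above 0 P"
      using assms by (simp add: SCH_iff)
    then have "x < y"
      using P x y by (auto simp: excess_def)
    moreover have "y \<le> psize P"
      using endpt_SCH[OF assms] P y by simp
    moreover have "\<exists>A B. P = A @ [D] @ B \<and> endpt A = (x - 1, y - 1) \<and> endpt (A @ [D]) = (x, y)"
      using P x y by (intro exI[of _ A] exI[of _ B]) simp
    ultimately show "(x, y) \<in> strict_edges P"
      unfolding strict_edges_def using x by simp
  qed (auto simp: strict_edges_def mem_diagonal_cells occurs_def prod_eq_iff)
qed

text \<open>The conditions of the strict edges are left to the weight, which vanishes when one is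
  violated. The index set then depends on the size of the path only, and words of equal size can be
  compared term by term or after an exchange of colours.\<close>

definition cols :: "nat \<Rightarrow> nat multiset \<Rightarrow> (nat \<Rightarrow> nat) set" where
  "cols n M = {\<kappa> \<in> {1..n} \<rightarrow>\<^sub>E {0<..}. image_mset \<kappa> (mset_set {1..n}) = M}"

lemma finite_cols: "finite (cols n M)"
proof (rule finite_subset)
  show "cols n M \<subseteq> {1..n} \<rightarrow>\<^sub>E set_mset M"
    unfolding cols_def by (auto simp: PiE_iff extensional_def)
  show "finite ({1..n} \<rightarrow>\<^sub>E set_mset M)"
    by (rule finite_PiE) auto
qed

lemma coeff_LLT:
  assumes "P \<in> SCH"
  shows "coeff_mps (LLT P) M = (\<Sum>\<kappa> \<in> cols (psize P) M. wt P 0 0 \<kappa>)"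
proof -
  have eq: "wt P 0 0 \<kappa> = (if \<forall>(x, y) \<in> strict_edges P. \<kappa> x < \<kappa> y then q ^ asc P \<kappa> else 0)" for \<kappa>
    unfolding wt_eq_power asc_def nonstrict_edges_eq[OF assms] strict_edges_eq[OF assms] ..
  show ?thesis
    unfolding LLT_def coeff_Abs_mps eq
    by (rule sum.mono_neutral_cong_left[OF finite_cols]) (auto simp: cols_def colorings_def)
qed

lemma coeff_mps_simps [simp]:
  "coeff_mps (f + g) M = coeff_mps f M + coeff_mps g M"
  "coeff_mps (f - g) M = coeff_mps f M - coeff_mps g M"
  "coeff_mps (scale_mps c f) M = c * coeff_mps f M"
  by (simp_all add: plus_mps_def minus_mps_def scale_mps_def)

section \<open>Elementary symmetric functions and products\<close>

text \<open>The word runs one unit above the diagonal, where the products over columns are empty and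
  only the strict edges between consecutive vertices contribute.\<close>

lemma wt_replicate_D_E:
  "wt (replicate k D @ [E]) i (Suc i) \<kappa> =
     (if \<forall>x \<in> {i<..i + k}. \<kappa> x < \<kappa> (Suc x) then 1 else 0)"
proof (induction k arbitrary: i)
  case (Suc k)
  have "{i<..i + Suc k} = insert (Suc i) {Suc i<..Suc i + k}"
    by auto
  then show ?case
    using Suc[of "Suc i"] by (simp add: strict_def)
qed simp

lemma increasing_cols:
  assumes "\<kappa> \<in> cols n M" and "\<forall>x \<in> {0<..<n}. \<kappa> x < \<kappa> (Suc x)"
  shows "inj_on \<kappa> {1..n}" "M = mset_set (\<kappa> ` {1..n})"
    "map \<kappa> [1..<Suc n] = sorted_list_of_set (\<kappa> ` {1..n})"
proof -
  have "sorted_wrt (<) (map \<kappa> [1..<Suc n])"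
    unfolding sorted_wrt_iff_nth_Suc_transp[OF transp_on_less]
    using assms(2) by (auto simp del: upt_Suc)
  then have *: "sorted (map \<kappa> [1..<Suc n])" "distinct (map \<kappa> [1..<Suc n])"
    by (simp_all only: strict_sorted_iff)
  then show inj: "inj_on \<kappa> {1..n}"
    by (simp only: distinct_map atLeastLessThanSuc_atLeastAtMost set_upt)
  show "M = mset_set (\<kappa> ` {1..n})"
    using assms(1) inj by (simp add: cols_def image_mset_mset_set)
  have "set (map \<kappa> [1..<Suc n]) = \<kappa> ` {1..n}"
    by (simp add: atLeastLessThanSuc_atLeastAtMost del: upt_Suc)
  then show "map \<kappa> [1..<Suc n] = sorted_list_of_set (\<kappa> ` {1..n})"
    using * sorted_list_of_set.idem_if_sorted_distinct by metis
qed

text \<open>An increasing coloring lists the elements of a set in order. So a content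
  \<open>M\<close> admits at most one, and it admits one exactly when \<open>M\<close> comes from an
  \<open>n\<close>-element set of positive integers.\<close>

lemma sum_increasing_cols:
  "(\<Sum>\<kappa> \<in> cols n M. if \<forall>x \<in> {0<..<n}. \<kappa> x < \<kappa> (Suc x) then 1 else 0) = coeff_mps (elem_sym n) M"
proof -
  let ?I = "{\<kappa> \<in> cols n M. \<forall>x \<in> {0<..<n}. \<kappa> x < \<kappa> (Suc x)}"
  have le1: "\<kappa> = \<kappa>'" if "\<kappa> \<in> ?I" "\<kappa>' \<in> ?I" for \<kappa> \<kappa>'
  proof -
    have "finite (\<kappa> ` {1..n})" "finite (\<kappa>' ` {1..n})"
      by auto
    then have "\<kappa> ` {1..n} = \<kappa>' ` {1..n}"
      using increasing_cols(2)[of \<kappa> n M] increasing_cols(2)[of \<kappa>' n M] that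
      by (metis (no_types, lifting) finite_set_mset_mset_set mem_Collect_eq)
    then have "map \<kappa> [1..<Suc n] = map \<kappa>' [1..<Suc n]"
      using increasing_cols(3)[of \<kappa> n M] increasing_cols(3)[of \<kappa>' n M] that by simp
    then have "\<kappa> x = \<kappa>' x" if "x \<in> {1..n}" for x
      using that by (simp add: atLeastLessThanSuc_atLeastAtMost del: upt_Suc)
    then show ?thesis
      using that by (intro PiE_ext[of \<kappa> "{1..n}" "\<lambda>_. {0<..}" \<kappa>']) (auto simp: cols_def)
  qed
  have "(\<Sum>\<kappa> \<in> cols n M. if \<forall>x \<in> {0<..<n}. \<kappa> x < \<kappa> (Suc x) then 1 else 0) = (of_nat (card ?I) :: K)"
    by (simp add: sum.If_cases finite_cols Int_def)
  also have "\<dots> = coeff_mps (elem_sym n) M"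
  proof (cases "\<exists>S. S \<subseteq> {0<..} \<and> finite S \<and> card S = n \<and> M = mset_set S")
    case True
    then obtain S where S: "S \<subseteq> {0<..}" "finite S" "card S = n" "M = mset_set S"
      by blast
    let ?l = "sorted_list_of_set S"
    define \<kappa> where "\<kappa> = (\<lambda>x\<in>{1..n}. ?l ! (x - 1))"
    have len: "length ?l = n"
      using S by simp
    have map: "map \<kappa> [1..<Suc n] = ?l"
      using len by (intro nth_equalityI) (auto simp: \<kappa>_def simp del: upt_Suc)
    have "image_mset \<kappa> (mset_set {1..n}) = mset (map \<kappa> [1..<Suc n])"
      by (simp only: mset_map mset_upt atLeastLessThanSuc_atLeastAtMost)
    also have "\<dots> = M"
      unfolding map using S by (metis mset_sorted_list_of_multiset sorted_list_of_mset_set)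
    finally have img: "image_mset \<kappa> (mset_set {1..n}) = M" .
    have "\<kappa> x \<in> S" if "x \<in> {1..n}" for x
      using that len S(2) nth_mem[of "x - 1" ?l] by (auto simp: \<kappa>_def)
    then have "\<kappa> \<in> {1..n} \<rightarrow>\<^sub>E {0<..}"
      using S(1) by (intro PiE_I) (blast, auto simp: \<kappa>_def)
    then have "\<kappa> \<in> cols n M"
      unfolding cols_def using img by simp
    moreover have "\<kappa> x < \<kappa> (Suc x)" if "x \<in> {0<..<n}" for x
      using that len sorted_wrt_nth_less[OF strict_sorted_list_of_set[of S], of "x - 1" x]
      by (auto simp: \<kappa>_def)
    ultimately have "?I = {\<kappa>}"
      using le1 by blast
    then have "card ?I = 1"
      by simp
    with True show ?thesis
      by (simp add: elem_sym_def)
  next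
    case False
    have "?I = {}"
    proof (rule equals0I)
      fix \<kappa>
      assume "\<kappa> \<in> ?I"
      then have \<kappa>: "\<kappa> \<in> cols n M" "\<forall>x \<in> {0<..<n}. \<kappa> x < \<kappa> (Suc x)"
        by auto
      have "\<kappa> ` {1..n} \<subseteq> {0<..}" "finite (\<kappa> ` {1..n})" "card (\<kappa> ` {1..n}) = n"
        using \<kappa>(1) increasing_cols(1)[OF \<kappa>] by (auto simp: cols_def card_image)
      with increasing_cols(2)[OF \<kappa>] False show False
        by blast
    qed
    then have "card ?I = 0"
      by (simp only: card.empty)
    with False show ?thesis
      by (simp add: elem_sym_def)
  qed
  finally show ?thesis .
qed

lemma excess_replicate_D [simp]: "excess (replicate k D) = 0"
  by (induction k) auto

lemma stays_above_replicate_D: "0 < h \<Longrightarrow> stays_above h (replicate k D)"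
  by (induction k) auto

lemma N_Ds_E_SCH: "[N] @ replicate k D @ [E] \<in> SCH"
  by (simp add: SCH_iff stays_above_replicate_D)

lemma psize_append [simp]: "psize (v @ w) = psize v + psize w"
  by (simp add: psize_def)

lemma psize_Cons [simp]:
  "psize (N # w) = psize w" "psize (E # w) = Suc (psize w)" "psize (D # w) = Suc (psize w)"
  "psize [] = 0"
  by (simp_all add: psize_def)

lemma LLT_N_Ds_E: "LLT ([N] @ replicate k D @ [E]) = elem_sym (k + 1)"
proof (rule mps_eqI)
  fix M
  have size: "psize ([N] @ replicate k D @ [E]) = k + 1"
    by (induction k) auto
  have "{0<..0 + k} = {0<..<k + 1}"
    by auto
  then have "wt ([N] @ replicate k D @ [E]) 0 0 \<kappa> =
      (if \<forall>x \<in> {0<..<k + 1}. \<kappa> x < \<kappa> (Suc x) then 1 else 0)" for \<kappa>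
    using wt_replicate_D_E[of k 0 \<kappa>] by simp
  then show "coeff_mps (LLT ([N] @ replicate k D @ [E])) M = coeff_mps (elem_sym (k + 1)) M"
    unfolding coeff_LLT[OF N_Ds_E_SCH] size by (simp add: sum_increasing_cols)
qed

section \<open>Multiplicativity\<close>

lemma wt_shift: "wt w (i + m) (j + m) \<kappa> = wt w i j (\<lambda>x. \<kappa> (x + m))"
proof (induction w i j "\<lambda>x. \<kappa> (x + m)" rule: wt.induct)
  have prod: "(\<Prod>y\<in>{Suc (Suc (i + m))..j + m}. ascent (\<kappa> (Suc (i + m))) (\<kappa> y)) =
      (\<Prod>y\<in>{Suc (Suc i)..j}. ascent (\<kappa> (Suc (i + m))) (\<kappa> (y + m)))" for i j
    using prod.shift_bounds_cl_nat_ivl[of _ "Suc (Suc i)" m j] by simp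
  {
    case (3 w i j)
    then show ?case using prod by simp
  next
    case (4 w i j)
    then show ?case using prod by simp
  }
qed auto

text \<open>A word reads only colours of vertices whose column or row it meets. \<open>min\<close>
  and \<open>max\<close> appear because the position relative to the diagonal is left open.\<close>

lemma wt_cong:
  assumes "\<And>x. min i j < x \<Longrightarrow> x \<le> max (i + fst (endpt w)) (j + snd (endpt w)) \<Longrightarrow> \<kappa> x = \<kappa>' x"
  shows "wt w i j \<kappa> = wt w i j \<kappa>'"
  using assms
proof (induction w i j \<kappa> rule: wt.induct)
  case (2 w i j \<kappa>)
  then show ?case by auto
next
  case (3 w i j \<kappa>)
  have "(\<Prod>y\<in>{Suc (Suc i)..j}. ascent (\<kappa> (Suc i)) (\<kappa> y)) =
      (\<Prod>y\<in>{Suc (Suc i)..j}. ascent (\<kappa>' (Suc i)) (\<kappa>' y))"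
    using 3(2) by (intro prod.cong) auto
  moreover have "wt w (Suc i) j \<kappa> = wt w (Suc i) j \<kappa>'"
    using 3(2) by (intro 3(1)) auto
  ultimately show ?case by simp
next
  case (4 w i j \<kappa>)
  have "(\<Prod>y\<in>{Suc (Suc i)..j}. ascent (\<kappa> (Suc i)) (\<kappa> y)) =
      (\<Prod>y\<in>{Suc (Suc i)..j}. ascent (\<kappa>' (Suc i)) (\<kappa>' y))"
    using 4(2) by (intro prod.cong) auto
  moreover have "strict (\<kappa> (Suc i)) (\<kappa> (Suc j)) = strict (\<kappa>' (Suc i)) (\<kappa>' (Suc j))"
    using 4(2) by auto
  moreover have "wt w (Suc i) (Suc j) \<kappa> = wt w (Suc i) (Suc j) \<kappa>'"
    using 4(2) by (intro 4(1)) auto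
  ultimately show ?case by simp
qed auto

lemma SCH_append: "P \<in> SCH \<Longrightarrow> Q \<in> SCH \<Longrightarrow> P @ Q \<in> SCH"
  by (simp add: SCH_iff)

definition join_cols :: "nat \<Rightarrow> nat \<Rightarrow> (nat \<Rightarrow> nat) \<Rightarrow> (nat \<Rightarrow> nat) \<Rightarrow> nat \<Rightarrow> nat" where
  "join_cols m n \<kappa> \<kappa>' = (\<lambda>x\<in>{1..m + n}. if x \<le> m then \<kappa> x else \<kappa>' (x - m))"

lemma image_mset_join:
  fixes \<kappa> :: "nat \<Rightarrow> 'b"
  shows "image_mset \<kappa> (mset_set {1..m + n}) =
     image_mset \<kappa> (mset_set {1..m}) + image_mset (\<lambda>x. \<kappa> (x + m)) (mset_set {1..n})"
proof -
  have "x \<in> (\<lambda>x. x + m) ` {1..n}" if "x \<in> {1..m + n}" "x \<notin> {1..m}" for x :: nat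
    using that by (intro image_eqI[of _ _ "x - m"]) auto
  then have "{1..m + n} = {1..m} \<union> (\<lambda>x. x + m) ` {1..n}"
    by fastforce
  then have "mset_set {1..m + n} = mset_set {1..m} + mset_set ((\<lambda>x. x + m) ` {1..n})"
    by (auto simp: mset_set_Union)
  also have "mset_set ((\<lambda>x. x + m) ` {1..n}) = image_mset (\<lambda>x. x + m) (mset_set {1..n})"
    by (simp add: image_mset_mset_set)
  finally show ?thesis
    by (simp add: image_mset.compositionality comp_def)
qed

text \<open>As \<open>P\<close> ends on the diagonal, no edge joins the first \<open>?m\<close>
  vertices to the others, and the weight of \<open>Q\<close> from there is a shifted copy. Cutting a
  coloring after \<open>?m\<close> is then a bijection onto pairs, sorted by the splittings of
  \<open>M\<close> that define the product of series.\<close>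

lemma LLT_append:
  assumes P: "P \<in> SCH" and Q: "Q \<in> SCH"
  shows "LLT (P @ Q) = LLT P * LLT Q"
proof (rule mps_eqI)
  fix M
  let ?m = "psize P" and ?n = "psize Q"
  have eP: "endpt P = (?m, ?m)" and eQ: "endpt Q = (?n, ?n)"
    using P Q by (auto intro: endpt_SCH)
  define S where "S = (SIGMA p:{(A, B). A + B = M}. cols ?m (fst p) \<times> cols ?n (snd p))"
  have "coeff_mps (LLT P * LLT Q) M =
      (\<Sum>p \<in> {(A, B). A + B = M}. \<Sum>r \<in> cols ?m (fst p) \<times> cols ?n (snd p).
         wt P 0 0 (fst r) * wt Q 0 0 (snd r))"
    by (simp add: times_mps_def coeff_LLT P Q sum_product sum.cartesian_product case_prod_unfold)
  also have "\<dots> = (\<Sum>(p, r) \<in> S. wt P 0 0 (fst r) * wt Q 0 0 (snd r))"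
    unfolding S_def by (subst sum.Sigma) (use finite_mset_splits finite_cols in auto)
  also have "\<dots> = (\<Sum>\<kappa> \<in> cols (?m + ?n) M. wt (P @ Q) 0 0 \<kappa>)"
  proof (rule sum.reindex_bij_witness[of _
        "\<lambda>\<kappa>. ((image_mset \<kappa> (mset_set {1..?m}), image_mset (\<lambda>x. \<kappa> (x + ?m)) (mset_set {1..?n})),
               (restrict \<kappa> {1..?m}, \<lambda>x\<in>{1..?n}. \<kappa> (x + ?m)))"
        "\<lambda>(p, r). join_cols ?m ?n (fst r) (snd r)"])
    fix a
    assume "a \<in> S"
    then obtain \<kappa> \<kappa>' where a: "a = ((image_mset \<kappa> (mset_set {1..?m}), image_mset \<kappa>' (mset_set {1..?n})), (\<kappa>, \<kappa>'))"
      and \<kappa>: "\<kappa> \<in> {1..?m} \<rightarrow>\<^sub>E {0<..}" and \<kappa>': "\<kappa>' \<in> {1..?n} \<rightarrow>\<^sub>E {0<..}"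
      and M: "image_mset \<kappa> (mset_set {1..?m}) + image_mset \<kappa>' (mset_set {1..?n}) = M"
      by (auto simp: S_def cols_def)
    let ?j = "join_cols ?m ?n \<kappa> \<kappa>'"
    have 1: "image_mset ?j (mset_set {1..?m}) = image_mset \<kappa> (mset_set {1..?m})"
      by (rule image_mset_cong) (auto simp: join_cols_def)
    have 2: "image_mset (\<lambda>x. ?j (x + ?m)) (mset_set {1..?n}) = image_mset \<kappa>' (mset_set {1..?n})"
      by (rule image_mset_cong) (auto simp: join_cols_def)
    have 3: "restrict ?j {1..?m} = \<kappa>"
      by (rule PiE_ext[OF _ \<kappa>]) (use \<kappa> in \<open>auto simp: join_cols_def PiE_iff\<close>)
    have 4: "(\<lambda>x\<in>{1..?n}. ?j (x + ?m)) = \<kappa>'"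
      by (rule PiE_ext[OF _ \<kappa>']) (use \<kappa>' in \<open>auto simp: join_cols_def PiE_iff\<close>)
    show "(\<lambda>\<kappa>. ((image_mset \<kappa> (mset_set {1..?m}), image_mset (\<lambda>x. \<kappa> (x + ?m)) (mset_set {1..?n})),
               (restrict \<kappa> {1..?m}, \<lambda>x\<in>{1..?n}. \<kappa> (x + ?m))))
          ((\<lambda>(p, r). join_cols ?m ?n (fst r) (snd r)) a) = a"
      using 1 2 3 4 by (simp add: a)
    have "image_mset ?j (mset_set {1..?m + ?n}) = M"
      using image_mset_join[of ?j ?m ?n] 1 2 M by simp
    moreover have "?j \<in> {1..?m + ?n} \<rightarrow>\<^sub>E {0<..}"
    proof (rule PiE_I)
      fix x
      assume "x \<in> {1..?m + ?n}"
      then show "?j x \<in> {0<..}"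
        using PiE_mem[OF \<kappa>, of x] PiE_mem[OF \<kappa>', of "x - ?m"]
        by (cases "x \<le> ?m") (force simp: join_cols_def)+
    qed (auto simp: join_cols_def)
    ultimately show "(\<lambda>(p, r). join_cols ?m ?n (fst r) (snd r)) a \<in> cols (?m + ?n) M"
      by (simp add: a cols_def)
    have "wt P 0 0 ?j = wt P 0 0 \<kappa>"
      by (rule wt_cong) (auto simp: eP join_cols_def)
    moreover have "wt Q 0 0 (\<lambda>x. ?j (x + ?m)) = wt Q 0 0 \<kappa>'"
      by (rule wt_cong) (auto simp: eQ join_cols_def)
    ultimately show "wt (P @ Q) 0 0 ((\<lambda>(p, r). join_cols ?m ?n (fst r) (snd r)) a) =
        (case a of (p, r) \<Rightarrow> wt P 0 0 (fst r) * wt Q 0 0 (snd r))"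
      using wt_shift[of Q 0 ?m 0 ?j] by (simp add: a wt_append eP)
  next
    fix \<kappa>
    assume "\<kappa> \<in> cols (?m + ?n) M"
    then have \<kappa>: "\<kappa> \<in> {1..?m + ?n} \<rightarrow>\<^sub>E {0<..}" and M: "image_mset \<kappa> (mset_set {1..?m + ?n}) = M"
      by (auto simp: cols_def)
    have 1: "image_mset (restrict \<kappa> {1..?m}) (mset_set {1..?m}) = image_mset \<kappa> (mset_set {1..?m})"
      by (rule image_mset_cong) auto
    have 2: "image_mset (\<lambda>x\<in>{1..?n}. \<kappa> (x + ?m)) (mset_set {1..?n}) =
        image_mset (\<lambda>x. \<kappa> (x + ?m)) (mset_set {1..?n})"
      by (rule image_mset_cong) auto
    have "restrict \<kappa> {1..?m} \<in> {1..?m} \<rightarrow>\<^sub>E {0<..}" "(\<lambda>x\<in>{1..?n}. \<kappa> (x + ?m)) \<in> {1..?n} \<rightarrow>\<^sub>E {0<..}"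
      using \<kappa> by (auto simp: PiE_iff)
    then show "((image_mset \<kappa> (mset_set {1..?m}), image_mset (\<lambda>x. \<kappa> (x + ?m)) (mset_set {1..?n})),
               (restrict \<kappa> {1..?m}, \<lambda>x\<in>{1..?n}. \<kappa> (x + ?m))) \<in> S"
      using 1 2 M image_mset_join[of \<kappa> ?m ?n] by (simp add: S_def cols_def)
    have "join_cols ?m ?n (restrict \<kappa> {1..?m}) (\<lambda>x\<in>{1..?n}. \<kappa> (x + ?m)) = \<kappa>"
      by (rule PiE_ext[OF _ \<kappa>]) (use \<kappa> in \<open>auto simp: join_cols_def PiE_iff\<close>)
    then show "(\<lambda>(p, r). join_cols ?m ?n (fst r) (snd r))
        ((image_mset \<kappa> (mset_set {1..?m}), image_mset (\<lambda>x. \<kappa> (x + ?m)) (mset_set {1..?n})),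
               (restrict \<kappa> {1..?m}, \<lambda>x\<in>{1..?n}. \<kappa> (x + ?m))) = \<kappa>"
      by simp
  qed
  finally show "coeff_mps (LLT (P @ Q)) M = coeff_mps (LLT P * LLT Q) M"
    by (simp add: coeff_LLT SCH_append P Q)
qed

section \<open>The corner relation\<close>

lemma corner_SCH:
  assumes "U @ [D] @ V \<in> SCH"
  shows "U @ [N, E] @ V \<in> SCH" "U @ [E, N] @ V \<in> SCH" "fst (endpt U) < snd (endpt U)"
  using assms stays_above_excess[of 0 U] by (auto simp: SCH_iff excess_def)

text \<open>The words differ only in the pair \<open>Suc ?i\<close>, \<open>Suc ?j\<close>: a
  nonstrict edge for \<open>[N, E]\<close>, none for \<open>[E, N]\<close>, a strict one for
  \<open>[D]\<close>. The respective factors are \<open>q\<close>, \<open>1\<close>,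
  \<open>1\<close> if the colours ascend and \<open>1\<close>, \<open>1\<close>, \<open>0\<close>
  otherwise.\<close>

lemma LLT_corner:
  assumes "U @ [D] @ V \<in> SCH"
  shows "LLT (U @ [N, E] @ V) - LLT (U @ [E, N] @ V) = scale_mps (q - 1) (LLT (U @ [D] @ V))"
proof (rule mps_eqI)
  fix M
  let ?i = "fst (endpt U)" and ?j = "snd (endpt U)"
  note SCH = corner_SCH[OF assms]
  have eq: "wt (U @ [N, E] @ V) 0 0 \<kappa> - wt (U @ [E, N] @ V) 0 0 \<kappa> =
      (q - 1) * wt (U @ [D] @ V) 0 0 \<kappa>" for \<kappa>
  proof -
    \<comment> \<open>\<open>SCH(3)\<close> matters here: for a corner on the diagonal the interval
      on the left would be empty.\<close>
    have "{Suc (Suc ?i)..Suc ?j} = insert (Suc ?j) {Suc (Suc ?i)..?j}"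
      using SCH(3) by auto
    then have "(\<Prod>y\<in>{Suc (Suc ?i)..Suc ?j}. ascent (\<kappa> (Suc ?i)) (\<kappa> y)) =
        ascent (\<kappa> (Suc ?i)) (\<kappa> (Suc ?j)) *
        (\<Prod>y\<in>{Suc (Suc ?i)..?j}. ascent (\<kappa> (Suc ?i)) (\<kappa> y))"
      by simp
    then show ?thesis
      by (simp add: wt_append ascent_def strict_def algebra_simps)
  qed
  have size: "psize (U @ [N, E] @ V) = psize (U @ [D] @ V)" "psize (U @ [E, N] @ V) = psize (U @ [D] @ V)"
    by simp_all
  show "coeff_mps (LLT (U @ [N, E] @ V) - LLT (U @ [E, N] @ V)) M =
      coeff_mps (scale_mps (q - 1) (LLT (U @ [D] @ V))) M"
    unfolding coeff_mps_simps coeff_LLT[OF SCH(1)] coeff_LLT[OF SCH(2)] coeff_LLT[OF assms] size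
      sum_distrib_left sum_subtractf[symmetric] eq ..
qed

section \<open>Exchanging the colours of two consecutive vertices\<close>

definition swp :: "nat \<Rightarrow> (nat \<Rightarrow> nat) \<Rightarrow> nat \<Rightarrow> nat" where
  "swp a \<kappa> = \<kappa> \<circ> Transposition.transpose a (Suc a)"

lemma swp_apply: "swp a \<kappa> x = (if x = a then \<kappa> (Suc a) else if x = Suc a then \<kappa> a else \<kappa> x)"
  by (simp add: swp_def Transposition.transpose_def)

lemma swp_swp [simp]: "swp a (swp a \<kappa>) = \<kappa>"
  by (auto simp: swp_apply)

lemma swp_cols:
  assumes "\<kappa> \<in> cols n M" "1 \<le> a" "a < n"
  shows "swp a \<kappa> \<in> cols n M"
proof -
  have perm: "Transposition.transpose a (Suc a) permutes {1..n}"
    using assms by (intro permutes_swap_id) auto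
  have "image_mset (swp a \<kappa>) (mset_set {1..n}) =
      image_mset \<kappa> (image_mset (Transposition.transpose a (Suc a)) (mset_set {1..n}))"
    by (simp add: swp_def image_mset.compositionality)
  also have "image_mset (Transposition.transpose a (Suc a)) (mset_set {1..n}) = mset_set {1..n}"
    using permutes_image[OF perm] permutes_inj_on[OF perm, of "{1..n}"]
    by (simp add: image_mset_mset_set)
  also have "image_mset \<kappa> (mset_set {1..n}) = M"
    using assms by (simp add: cols_def)
  moreover have "swp a \<kappa> \<in> {1..n} \<rightarrow>\<^sub>E {0<..}"
    using assms by (auto simp: cols_def PiE_iff extensional_def swp_apply)
  ultimately show ?thesis
    by (simp add: cols_def)
qed

lemma sum_swp:
  assumes "1 \<le> a" "a < n"
  shows "(\<Sum>\<kappa> \<in> cols n M. f (swp a \<kappa>)) = (\<Sum>\<kappa> \<in> cols n M. f \<kappa>)"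
  by (rule sum.reindex_bij_witness[of _ "swp a" "swp a"]) (auto intro: swp_cols assms)

text \<open>The word starts above the rows \<open>a\<close> and \<open>a + 1\<close> and stops
  before the columns \<open>a\<close> and \<open>a + 1\<close>. So every column it crosses contains
  both rows, its strict edges end in higher rows, and the exchange only permutes factors.\<close>

lemma wt_swp:
  assumes "a < j" "i + fst (endpt w) < a"
  shows "wt w i j (swp a \<kappa>) = wt w i j \<kappa>"
  using assms
proof (induction w i j \<kappa> rule: wt.induct)
  have prod: "(\<Prod>y\<in>{Suc (Suc i)..j}. ascent (swp a \<kappa> (Suc i)) (swp a \<kappa> y)) =
      (\<Prod>y\<in>{Suc (Suc i)..j}. ascent (\<kappa> (Suc i)) (\<kappa> y))" if "Suc i < a" "a < j" for i j \<kappa>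
  proof -
    have "Transposition.transpose a (Suc a) permutes {Suc (Suc i)..j}"
      using that by (intro permutes_swap_id) auto
    from prod.permute[OF this, of "\<lambda>y. ascent (\<kappa> (Suc i)) (\<kappa> y)"] show ?thesis
      using that by (simp add: swp_def comp_def)
  qed
  {
    case (3 w i j \<kappa>)
    then show ?case using prod by simp
  next
    case (4 w i j \<kappa>)
    then show ?case using prod by (simp add: swp_apply)
  }
qed auto

text \<open>Adding to each coloring its exchanged copy counts every sum twice; this factor has to be
  cancelled at the end.\<close>

lemma two_neq_zero: "(2 :: K) \<noteq> 0"
proof
  assume "(2 :: K) = 0"
  then have "Fract (of_nat 2 :: rat poly) 1 = Fract 0 1"
    unfolding Fract_of_nat_eq by (simp add: Zero_fract_def)
  then show False
    by (simp add: eq_fract)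
qed

definition depends_below :: "nat \<Rightarrow> ((nat \<Rightarrow> nat) \<Rightarrow> K) \<Rightarrow> bool" where
  "depends_below b h \<longleftrightarrow> (\<forall>\<kappa> \<kappa>'. (\<forall>x<b. \<kappa> x = \<kappa>' x) \<longrightarrow> h \<kappa> = h \<kappa>')"

lemma depends_belowD: "depends_below b h \<Longrightarrow> (\<And>x. x < b \<Longrightarrow> \<kappa> x = \<kappa>' x) \<Longrightarrow> h \<kappa> = h \<kappa>'"
  unfolding depends_below_def by blast

text \<open>
  For the two distributions of two colours on the vertices \<open>a\<close> and \<open>a + 1\<close>, this relation between
  prefix weights is preserved when a bounce point is passed, and it contains the three relations
  between the bottom ends of the paths.
\<close>

definition dual :: "nat \<Rightarrow> ((nat \<Rightarrow> nat) \<Rightarrow> K) \<Rightarrow> ((nat \<Rightarrow> nat) \<Rightarrow> K) \<Rightarrow> bool" where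
  "dual a h h' \<longleftrightarrow> (\<forall>\<kappa>.
     (\<kappa> a < \<kappa> (Suc a) \<longrightarrow> h' \<kappa> = (q - 1) * h \<kappa> + h (swp a \<kappa>) \<and> h' (swp a \<kappa>) = q * h \<kappa>) \<and>
     (\<kappa> a = \<kappa> (Suc a) \<longrightarrow> h' \<kappa> = q * h \<kappa>))"

definition good :: "nat \<Rightarrow> nat \<Rightarrow> nat \<Rightarrow> step list \<Rightarrow> step list \<Rightarrow> bool" where
  "good n i j R R' \<longleftrightarrow> (\<forall>M h h'.
     depends_below (Suc j) h \<longrightarrow> depends_below (Suc j) h' \<longrightarrow> dual (Suc i) h h' \<longrightarrow>
     (\<Sum>\<kappa> \<in> cols n M. h \<kappa> * wt R i j \<kappa>) = (\<Sum>\<kappa> \<in> cols n M. h' \<kappa> * wt R' i j \<kappa>))"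

text \<open>Of two different colours the definition treats only the increasing order; the other
  order follows by applying it to \<open>swp a \<kappa>\<close>.\<close>

lemma dual_cases:
  assumes "dual a h h'"
  shows "\<kappa> a < \<kappa> (Suc a) \<Longrightarrow> h' \<kappa> = (q - 1) * h \<kappa> + h (swp a \<kappa>)"
    and "\<kappa> a < \<kappa> (Suc a) \<Longrightarrow> h' (swp a \<kappa>) = q * h \<kappa>"
    and "\<kappa> (Suc a) < \<kappa> a \<Longrightarrow> h' \<kappa> = q * h (swp a \<kappa>)"
    and "\<kappa> (Suc a) < \<kappa> a \<Longrightarrow> h' (swp a \<kappa>) = (q - 1) * h (swp a \<kappa>) + h \<kappa>"
    and "\<kappa> a = \<kappa> (Suc a) \<Longrightarrow> h' \<kappa> = q * h \<kappa>"
    and "\<kappa> a = \<kappa> (Suc a) \<Longrightarrow> h' (swp a \<kappa>) = q * h (swp a \<kappa>)"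
proof -
  note dual = assms[unfolded dual_def, rule_format]
  have swp: "swp a \<kappa> a = \<kappa> (Suc a)" "swp a \<kappa> (Suc a) = \<kappa> a"
    by (simp_all add: swp_apply)
  show "\<kappa> a < \<kappa> (Suc a) \<Longrightarrow> h' \<kappa> = (q - 1) * h \<kappa> + h (swp a \<kappa>)"
    "\<kappa> a < \<kappa> (Suc a) \<Longrightarrow> h' (swp a \<kappa>) = q * h \<kappa>" "\<kappa> a = \<kappa> (Suc a) \<Longrightarrow> h' \<kappa> = q * h \<kappa>"
    using dual[of \<kappa>] by blast+
  show "\<kappa> (Suc a) < \<kappa> a \<Longrightarrow> h' \<kappa> = q * h (swp a \<kappa>)"
    "\<kappa> (Suc a) < \<kappa> a \<Longrightarrow> h' (swp a \<kappa>) = (q - 1) * h (swp a \<kappa>) + h \<kappa>"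
    "\<kappa> a = \<kappa> (Suc a) \<Longrightarrow> h' (swp a \<kappa>) = q * h (swp a \<kappa>)"
    using dual[of "swp a \<kappa>"] unfolding swp_swp swp by auto
qed

section \<open>Summation over an exchanged pair and propagation of duality\<close>

lemma sum_symmetrize:
  assumes "1 \<le> a" "a < n"
  shows "2 * (\<Sum>\<kappa> \<in> cols n M. f \<kappa>) = (\<Sum>\<kappa> \<in> cols n M. f \<kappa> + f (swp a \<kappa>) :: K)"
  by (simp add: sum.distrib sum_swp[OF assms])

lemma prod_ascent_two:
  assumes "Suc (Suc i) \<le> j"
  shows "(\<Prod>y\<in>{Suc (Suc i)..j}. ascent (\<kappa> (Suc i)) (\<kappa> y)) =
    ascent (\<kappa> (Suc i)) (\<kappa> (Suc (Suc i))) *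
    (\<Prod>y\<in>{Suc (Suc (Suc i))..j}. ascent (\<kappa> (Suc i)) (\<kappa> y))"
  using assms by (simp add: prod.atLeast_Suc_atMost)

lemma prod_ascent_last:
  assumes "i \<le> j"
  shows "(\<Prod>y\<in>{i..Suc j}. ascent a (\<kappa> y)) = ascent a (\<kappa> (Suc j)) * (\<Prod>y\<in>{i..j}. ascent a (\<kappa> y))"
  using assms by (simp add: prod.nat_ivl_Suc' mult.commute)

lemma swp_prod:
  "(\<Prod>y\<in>{Suc (Suc a)..j}. ascent b (swp a \<kappa> y)) = (\<Prod>y\<in>{Suc (Suc a)..j}. ascent b (\<kappa> y))"
  by (intro prod.cong) (auto simp: swp_apply)

text \<open>\<open>p\<close>, \<open>r\<close> are the colours of the pair and \<open>s\<close> is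
  that of the vertex where the top strict edge ends; \<open>x\<close>, \<open>y\<close> and
  \<open>x'\<close>, \<open>y'\<close> are the values of \<open>h\<close> and \<open>h'\<close>
  before and after the exchange. With \<open>[D, E]\<close> the strict edge leaves the first vertex
  and the second has a nonstrict edge to the same end; with \<open>[E, D]\<close> there is only a
  strict edge from the second.\<close>

lemma top_algebra:
  fixes Q x y x' y' :: K and p r s :: nat
  assumes dual: "p < r \<Longrightarrow> x' = (q - 1) * x + y" "p < r \<Longrightarrow> y' = q * x"
    "r < p \<Longrightarrow> x' = q * y" "r < p \<Longrightarrow> y' = (q - 1) * y + x"
    "p = r \<Longrightarrow> x' = q * x" "p = r \<Longrightarrow> y' = q * y"
  shows "x * (Q * (ascent p r * strict p s * ascent r s)) +
      y * (Q * (ascent r p * strict r s * ascent p s)) =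
    x' * (Q * (ascent p r * strict r s)) + y' * (Q * (ascent r p * strict p s))"
proof (cases p r rule: linorder_cases)
  case less
  then show ?thesis
    unfolding dual(1,2)[OF less] ascent_def strict_def
    by (cases "p < s"; cases "r < s"; simp add: algebra_simps)
next
  case equal
  then show ?thesis
    unfolding dual(5,6)[OF equal] ascent_def strict_def
    by (cases "r < s"; simp add: algebra_simps)
next
  case greater
  then show ?thesis
    unfolding dual(3,4)[OF greater] ascent_def strict_def
    by (cases "p < s"; cases "r < s"; simp add: algebra_simps)
qed

text \<open>\<open>p\<close>, \<open>r\<close> colour the lower pair and \<open>s\<close>,
  \<open>t\<close> the upper one; \<open>G\<close> sums over both placements of \<open>p\<close> and
  \<open>r\<close>. Its factors are the nonstrict edge inside the lower pair, the strict edges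
  between first and between second vertices, and the nonstrict edge from the second lower to the
  first upper vertex. Summing with this kernel intertwines the two Hecke operators.\<close>

lemma step_algebra:
  fixes Q x y x' y' :: K and p r s t :: nat
  defines "G \<equiv> \<lambda>u v s t. Q * (u * (ascent p r * strict p s * strict r t * ascent r s) +
    v * (ascent r p * strict r s * strict p t * ascent p s))"
  assumes dual: "p < r \<Longrightarrow> x' = (q - 1) * x + y" "p < r \<Longrightarrow> y' = q * x"
    "r < p \<Longrightarrow> x' = q * y" "r < p \<Longrightarrow> y' = (q - 1) * y + x"
    "p = r \<Longrightarrow> x' = q * x" "p = r \<Longrightarrow> y' = q * y"
  shows "(s < t \<longrightarrow> G x' y' s t = (q - 1) * G x y s t + G x y t s \<and> G x' y' t s = q * G x y s t) \<and>
    (s = t \<longrightarrow> G x' y' s t = q * G x y s t)"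
proof (cases p r rule: linorder_cases)
  case less
  then show ?thesis
    unfolding dual(1,2)[OF less] G_def ascent_def strict_def
    by (cases "p < s"; cases "r < s"; cases "p < t"; cases "r < t"; simp add: algebra_simps)
next
  case equal
  then show ?thesis
    unfolding dual(5,6)[OF equal] G_def ascent_def strict_def
    by (cases "r < s"; cases "r < t"; simp add: algebra_simps)
next
  case greater
  then show ?thesis
    unfolding dual(3,4)[OF greater] G_def ascent_def strict_def
    by (cases "p < s"; cases "r < s"; cases "p < t"; cases "r < t"; simp add: algebra_simps)
qed

text \<open>Apart from the factors in \<open>top_algebra\<close> everything is symmetric in the pair
  \<open>?a\<close>, \<open>Suc ?a\<close>: above the pair both columns contain the same rows up to
  \<open>j\<close>, and \<open>W\<close> starts to the right of both.\<close>

lemma good_top: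
  assumes "i + 2 \<le> j" "j < n" "endpt W = (n - i - 2, n - j - 1)"
  shows "good n i j (D # E # W) (E # D # W)"
  unfolding good_def
proof (intro allI impI)
  fix M h h'
  assume "dual (Suc i) h h'"
  note dual = dual_cases[OF this]
  let ?a = "Suc i"
  have a: "1 \<le> ?a" "?a < n"
    using assms by auto
  define Q where "Q = (\<lambda>\<kappa>. (\<Prod>y\<in>{Suc (Suc ?a)..j}. ascent (\<kappa> ?a) (\<kappa> y)) *
    (\<Prod>y\<in>{Suc (Suc ?a)..j}. ascent (\<kappa> (Suc ?a)) (\<kappa> y)) * wt W (Suc ?a) (Suc j) \<kappa>)"
  have "wt W (Suc ?a) (Suc j) (swp ?a \<kappa>) = wt W (Suc ?a) (Suc j) \<kappa>" for \<kappa>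
    using assms by (intro wt_cong) (auto simp: swp_apply)
  then have Q: "Q (swp ?a \<kappa>) = Q \<kappa>" for \<kappa>
    by (simp add: Q_def swp_prod[of ?a, simplified]) (simp add: swp_apply)
  have R: "wt (D # E # W) i j \<kappa> = Q \<kappa> * (ascent (\<kappa> ?a) (\<kappa> (Suc ?a)) *
      strict (\<kappa> ?a) (\<kappa> (Suc j)) * ascent (\<kappa> (Suc ?a)) (\<kappa> (Suc j)))" for \<kappa>
    using assms by (simp add: Q_def prod_ascent_two[of i j] prod_ascent_last algebra_simps)
  have R': "wt (E # D # W) i j \<kappa> = Q \<kappa> * (ascent (\<kappa> ?a) (\<kappa> (Suc ?a)) *
      strict (\<kappa> (Suc ?a)) (\<kappa> (Suc j)))" for \<kappa>
    using assms by (simp add: Q_def prod_ascent_two[of i j] algebra_simps)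
  have swp: "swp ?a \<kappa> ?a = \<kappa> (Suc ?a)" "swp ?a \<kappa> (Suc ?a) = \<kappa> ?a" "swp ?a \<kappa> (Suc j) = \<kappa> (Suc j)" for \<kappa>
    using assms by (auto simp: swp_apply)
  have "h \<kappa> * wt (D # E # W) i j \<kappa> + h (swp ?a \<kappa>) * wt (D # E # W) i j (swp ?a \<kappa>) =
      h' \<kappa> * wt (E # D # W) i j \<kappa> + h' (swp ?a \<kappa>) * wt (E # D # W) i j (swp ?a \<kappa>)" for \<kappa>
    unfolding R R' Q swp
    by (rule top_algebra) (fact dual)+
  then have "2 * (\<Sum>\<kappa> \<in> cols n M. h \<kappa> * wt (D # E # W) i j \<kappa>) =
      2 * (\<Sum>\<kappa> \<in> cols n M. h' \<kappa> * wt (E # D # W) i j \<kappa>)"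
    unfolding sum_symmetrize[OF a] by simp
  then show "(\<Sum>\<kappa> \<in> cols n M. h \<kappa> * wt (D # E # W) i j \<kappa>) =
      (\<Sum>\<kappa> \<in> cols n M. h' \<kappa> * wt (E # D # W) i j \<kappa>)"
    using two_neq_zero by simp
qed

text \<open>\<open>[D, D]\<close> joins the lower pair to the upper pair by two strict edges.
  \<open>V\<close> is neutral for both exchanges: it starts to the right of the lower columns, and
  it meets the upper pair as in \<open>wt_swp\<close>. So summing over the lower exchange turns a
  dual pair at \<open>(i2, i)\<close> into one at \<open>(i, j)\<close>, where the hypothesis on the
  suffixes applies.\<close>

lemma good_step:
  assumes good: "good n i j R R'"
    and V: "endpt V = (i - i2 - 2, j - i - 2)"
    and ij: "i2 + 2 \<le> i" "i + 2 \<le> j" "j < n"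
  shows "good n i2 i ([D, D] @ V @ R) ([D, D] @ V @ R')"
  unfolding good_def
proof (intro allI impI)
  fix M h h'
  assume h: "depends_below (Suc i) h" and h': "depends_below (Suc i) h'"
  assume "dual (Suc i2) h h'"
  note dual = dual_cases[OF this]
  let ?a = "Suc i" and ?b = "Suc i2"
  have b: "1 \<le> ?b" "?b < n"
    using ij by auto
  define c where "c = wt ([D, D] @ V) i2 i"
  define Q where "Q = (\<lambda>\<kappa>. (\<Prod>y\<in>{Suc (Suc ?b)..i}. ascent (\<kappa> ?b) (\<kappa> y)) *
    (\<Prod>y\<in>{Suc (Suc ?b)..i}. ascent (\<kappa> (Suc ?b)) (\<kappa> y)) * wt V (Suc ?b) (Suc ?a) \<kappa>)"
  have c: "c \<kappa> = Q \<kappa> * (ascent (\<kappa> ?b) (\<kappa> (Suc ?b)) * strict (\<kappa> ?b) (\<kappa> ?a) *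
      strict (\<kappa> (Suc ?b)) (\<kappa> (Suc ?a)) * ascent (\<kappa> (Suc ?b)) (\<kappa> ?a))" for \<kappa>
    using ij by (simp add: c_def Q_def prod_ascent_two[of i2 i] prod_ascent_last algebra_simps)
  have "wt V (Suc ?b) (Suc ?a) (swp ?b \<kappa>) = wt V (Suc ?b) (Suc ?a) \<kappa>" for \<kappa>
    using ij by (intro wt_cong) (auto simp: swp_apply)
  then have Qb: "Q (swp ?b \<kappa>) = Q \<kappa>" for \<kappa>
    by (simp add: Q_def swp_prod[of ?b, simplified]) (simp add: swp_apply)
  have "wt V (Suc ?b) (Suc ?a) (swp ?a \<kappa>) = wt V (Suc ?b) (Suc ?a) \<kappa>" for \<kappa>
    using ij by (intro wt_swp) (auto simp: V)
  moreover have "(\<Prod>y\<in>{Suc (Suc ?b)..i}. ascent l (swp ?a \<kappa> y)) = (\<Prod>y\<in>{Suc (Suc ?b)..i}. ascent l (\<kappa> y))" for l \<kappa>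
    by (intro prod.cong) (auto simp: swp_apply)
  ultimately have Qa: "Q (swp ?a \<kappa>) = Q \<kappa>" for \<kappa>
    using ij by (simp add: Q_def) (simp add: swp_apply)
  have full: "wt ([D, D] @ V @ X) i2 i \<kappa> = c \<kappa> * wt X i j \<kappa>" for X \<kappa>
  proof -
    have "i2 + fst (endpt ([D, D] @ V)) = i" "i + snd (endpt ([D, D] @ V)) = j"
      using ij by (simp_all add: V)
    then show ?thesis
      using wt_append[of "[D, D] @ V" X i2 i \<kappa>] unfolding c_def append_assoc by simp
  qed
  \<comment> \<open>The prefix weight at \<open>(i, j)\<close>, summed over both placements of the
    lower colours; the suffix does not read these and factors out.\<close>
  define H where "H = (\<lambda>f \<kappa>. f \<kappa> * c \<kappa> + f (swp ?b \<kappa>) * c (swp ?b \<kappa>))"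
  have sum: "2 * (\<Sum>\<kappa> \<in> cols n M. f \<kappa> * wt ([D, D] @ V @ X) i2 i \<kappa>) =
      (\<Sum>\<kappa> \<in> cols n M. H f \<kappa> * wt X i j \<kappa>)" for f X
  proof -
    have "wt X i j (swp ?b \<kappa>) = wt X i j \<kappa>" for \<kappa>
      using ij by (intro wt_cong) (auto simp: swp_apply)
    then show ?thesis
      unfolding sum_symmetrize[OF b] full by (simp add: H_def algebra_simps)
  qed
  have dep: "depends_below (Suc j) (H f)" if f: "depends_below (Suc i) f" for f
    unfolding depends_below_def
  proof (intro allI impI)
    fix \<kappa> \<kappa>' :: "nat \<Rightarrow> nat"
    assume eq: "\<forall>x<Suc j. \<kappa> x = \<kappa>' x"
    have eq': "\<forall>x<Suc j. swp ?b \<kappa> x = swp ?b \<kappa>' x"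
      using eq ij by (auto simp: swp_apply)
    have "c \<mu> = c \<mu>'" if "\<forall>x<Suc j. \<mu> x = \<mu>' x" for \<mu> \<mu>'
      unfolding c_def using ij that by (intro wt_cong) (auto simp: V)
    moreover have "f \<mu> = f \<mu>'" if "\<forall>x<Suc j. \<mu> x = \<mu>' x" for \<mu> \<mu>'
      using that ij by (intro depends_belowD[OF f]) simp
    ultimately have "c \<kappa> = c \<kappa>'" "c (swp ?b \<kappa>) = c (swp ?b \<kappa>')"
      "f \<kappa> = f \<kappa>'" "f (swp ?b \<kappa>) = f (swp ?b \<kappa>')"
      using eq eq' by blast+
    then show "H f \<kappa> = H f \<kappa>'"
      by (simp add: H_def)
  qed
  have "dual ?a (H h) (H h')"
    unfolding dual_def
  proof (rule allI)
    fix \<kappa>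
    have swp: "swp ?a \<kappa> ?a = \<kappa> (Suc ?a)" "swp ?a \<kappa> (Suc ?a) = \<kappa> ?a" "swp ?a \<kappa> ?b = \<kappa> ?b"
      "swp ?a \<kappa> (Suc ?b) = \<kappa> (Suc ?b)"
      "swp ?b \<kappa> ?a = \<kappa> ?a" "swp ?b \<kappa> (Suc ?a) = \<kappa> (Suc ?a)" "swp ?b \<kappa> ?b = \<kappa> (Suc ?b)"
      "swp ?b \<kappa> (Suc ?b) = \<kappa> ?b" 
      "swp ?b (swp ?a \<kappa>) ?a = \<kappa> (Suc ?a)" "swp ?b (swp ?a \<kappa>) (Suc ?a) = \<kappa> ?a"
      "swp ?b (swp ?a \<kappa>) ?b = \<kappa> (Suc ?b)" "swp ?b (swp ?a \<kappa>) (Suc ?b) = \<kappa> ?b"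
      using ij by (auto simp: swp_apply)
    \<comment> \<open>\<open>f\<close> reads nothing from vertex \<open>i + 1\<close> on, hence
      neither vertex of the upper pair. This is the purpose of the bounds in
      \<open>depends_below\<close>.\<close>
    have inv: "f (swp ?a \<kappa>) = f \<kappa>" "f (swp ?b (swp ?a \<kappa>)) = f (swp ?b \<kappa>)"
      if "depends_below (Suc i) f" for f
      using ij by (auto intro!: depends_belowD[OF that] simp: swp_apply)
    have eqs: "H f \<kappa> = Q \<kappa> * (f \<kappa> * (ascent (\<kappa> ?b) (\<kappa> (Suc ?b)) * strict (\<kappa> ?b) (\<kappa> ?a) *
          strict (\<kappa> (Suc ?b)) (\<kappa> (Suc ?a)) * ascent (\<kappa> (Suc ?b)) (\<kappa> ?a)) +
        f (swp ?b \<kappa>) * (ascent (\<kappa> (Suc ?b)) (\<kappa> ?b) * strict (\<kappa> (Suc ?b)) (\<kappa> ?a) *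
          strict (\<kappa> ?b) (\<kappa> (Suc ?a)) * ascent (\<kappa> ?b) (\<kappa> ?a)))"
      "H f (swp ?a \<kappa>) = Q \<kappa> * (f \<kappa> * (ascent (\<kappa> ?b) (\<kappa> (Suc ?b)) * strict (\<kappa> ?b) (\<kappa> (Suc ?a)) *
          strict (\<kappa> (Suc ?b)) (\<kappa> ?a) * ascent (\<kappa> (Suc ?b)) (\<kappa> (Suc ?a))) +
        f (swp ?b \<kappa>) * (ascent (\<kappa> (Suc ?b)) (\<kappa> ?b) * strict (\<kappa> (Suc ?b)) (\<kappa> (Suc ?a)) *
          strict (\<kappa> ?b) (\<kappa> ?a) * ascent (\<kappa> ?b) (\<kappa> (Suc ?a))))"
      if "depends_below (Suc i) f" for f
      unfolding H_def c Qa Qb swp inv[OF that] by (simp_all only: distrib_left mult_ac)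
    show "(\<kappa> ?a < \<kappa> (Suc ?a) \<longrightarrow> H h' \<kappa> = (q - 1) * H h \<kappa> + H h (swp ?a \<kappa>) \<and>
        H h' (swp ?a \<kappa>) = q * H h \<kappa>) \<and> (\<kappa> ?a = \<kappa> (Suc ?a) \<longrightarrow> H h' \<kappa> = q * H h \<kappa>)"
      unfolding eqs[OF h] eqs[OF h'] by (rule step_algebra) (fact dual)+
  qed
  then have "(\<Sum>\<kappa> \<in> cols n M. H h \<kappa> * wt R i j \<kappa>) = (\<Sum>\<kappa> \<in> cols n M. H h' \<kappa> * wt R' i j \<kappa>)"
    using good dep[OF h] dep[OF h'] unfolding good_def by blast
  then have "2 * (\<Sum>\<kappa> \<in> cols n M. h \<kappa> * wt ([D, D] @ V @ R) i2 i \<kappa>) =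
      2 * (\<Sum>\<kappa> \<in> cols n M. h' \<kappa> * wt ([D, D] @ V @ R') i2 i \<kappa>)"
    unfolding sum .
  then show "(\<Sum>\<kappa> \<in> cols n M. h \<kappa> * wt ([D, D] @ V @ R) i2 i \<kappa>) =
      (\<Sum>\<kappa> \<in> cols n M. h' \<kappa> * wt ([D, D] @ V @ R') i2 i \<kappa>)"
    using two_neq_zero by simp
qed

section \<open>The bounce relations\<close>

text \<open>A weakening of \<^const>\<open>bounce\<close> whose existence at the first east step is easier to show.\<close>

inductive chain :: "step list \<Rightarrow> nat \<times> nat \<Rightarrow> nat \<times> nat \<Rightarrow> bool" for P where
  chain_stop: "chain P (u1, u0) (u2, u1)"
| chain_on: "between_diagonals P (u2, u1) \<Longrightarrow> chain P (u2, u1) p \<Longrightarrow> chain P (u1, u0) p"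

lemma bounce_chain: "bounce P p p' \<Longrightarrow> chain P p p'"
  by (induction rule: bounce.induct) (auto intro: chain.intros)

text \<open>The height never decreases along a word and \<open>t\<close> raises it, so
  \<open>X\<close> cannot already contain all of \<open>A\<close>.\<close>

lemma prefix_by_height:
  assumes eq: "A @ R = X @ [t] @ Y" and t: "t \<in> {N, D}"
    and height: "snd (endpt (X @ [t])) \<le> snd (endpt A)"
  obtains Z where "A = X @ [t] @ Z"
proof -
  from eq have "(\<exists>Z. A = X @ Z \<and> Z @ R = t # Y) \<or> (\<exists>Z. X = A @ Z)"
    by (auto simp: append_eq_append_conv2)
  moreover have "\<nexists>Z. X = A @ Z"
    using height t by (auto simp: endpt_def)
  moreover have "Z \<noteq> []" if "A = X @ Z" for Z
    using that height t by (auto simp: endpt_def)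
  ultimately show ?thesis
    using that by (auto simp: append_eq_Cons_conv)
qed

text \<open>A coefficient that makes sense for every word, so that relations can be established
  before the rewritten words are known to be paths.\<close>

definition wsum :: "nat \<Rightarrow> nat multiset \<Rightarrow> step list \<Rightarrow> K" where
  "wsum n M w = (\<Sum>\<kappa> \<in> cols n M. wt w 0 0 \<kappa>)"

definition bounce_rel :: "nat \<Rightarrow> step list \<Rightarrow> step \<Rightarrow> step \<Rightarrow> step list \<Rightarrow> step list \<Rightarrow> bool" where
  "bounce_rel n U s t X X' \<longleftrightarrow> (\<forall>M.
     ((s, t) = (N, N) \<longrightarrow> wsum n M (U @ [N, N] @ X) = q * wsum n M (U @ [N, N] @ X')) \<and>
     ((s, t) = (D, N) \<longrightarrow> wsum n M (U @ [D, N] @ X) = wsum n M (U @ [N, D] @ X')) \<and>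
     ((s, t) = (N, D) \<longrightarrow> wsum n M (U @ [N, D] @ X) =
        (q - 1) * wsum n M (U @ [N, D] @ X') + q * wsum n M (U @ [D, N] @ X')))"

text \<open>Only the column \<open>Suc w\<close> distinguishes the two vertices. If it has colour
  \<open>l\<close>, its factors are
  \<open>ascent l (\<kappa> ?a) * strict l (\<kappa> (Suc ?a))\<close> for \<open>[N, D]\<close> and
  \<open>strict l (\<kappa> ?a)\<close> for \<open>[D, N]\<close>. The second claim is what the
  first becomes under the quadratic relation of the Hecke operator.\<close>

lemma bottom_dual:
  assumes "endpt U = (w, i)" "Suc w \<le> i" "Suc w + fst (endpt V) \<le> i"
  defines "h \<equiv> \<lambda>s t. wt (U @ [s, t] @ V) 0 0"
  shows "dual (Suc i) (h D N) (h N D)"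
    and "dual (Suc i) (h N D) (\<lambda>\<kappa>. (q - 1) * h N D \<kappa> + q * h D N \<kappa>)"
proof -
  let ?a = "Suc i"
  define Q where "Q = (\<lambda>\<kappa>. wt U 0 0 \<kappa> * (\<Prod>y\<in>{Suc (Suc w)..i}. ascent (\<kappa> (Suc w)) (\<kappa> y)) *
    wt V (Suc w) (Suc ?a) \<kappa>)"
  have "wt U 0 0 (swp ?a \<kappa>) = wt U 0 0 \<kappa>" for \<kappa>
    using assms by (intro wt_cong) (auto simp: swp_apply)
  moreover have "(\<Prod>y\<in>{Suc (Suc w)..i}. ascent l (swp ?a \<kappa> y)) =
      (\<Prod>y\<in>{Suc (Suc w)..i}. ascent l (\<kappa> y))" for l \<kappa>
    by (intro prod.cong) (auto simp: swp_apply)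
  moreover have "wt V (Suc w) (Suc ?a) (swp ?a \<kappa>) = wt V (Suc w) (Suc ?a) \<kappa>" for \<kappa>
    using assms by (intro wt_swp) auto
  moreover have "swp ?a \<kappa> (Suc w) = \<kappa> (Suc w)" for \<kappa>
    using assms by (simp add: swp_apply)
  ultimately have Q: "Q (swp ?a \<kappa>) = Q \<kappa>" for \<kappa>
    by (simp add: Q_def)
  have ND: "h N D \<kappa> = Q \<kappa> * (ascent (\<kappa> (Suc w)) (\<kappa> ?a) * strict (\<kappa> (Suc w)) (\<kappa> (Suc ?a)))" for \<kappa>
    using assms by (simp add: h_def Q_def wt_append prod_ascent_last algebra_simps)
  have DN: "h D N \<kappa> = Q \<kappa> * strict (\<kappa> (Suc w)) (\<kappa> ?a)" for \<kappa>
    using assms by (simp add: h_def Q_def wt_append algebra_simps)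
  have swp: "swp ?a \<kappa> (Suc w) = \<kappa> (Suc w)" "swp ?a \<kappa> ?a = \<kappa> (Suc ?a)" "swp ?a \<kappa> (Suc ?a) = \<kappa> ?a" for \<kappa>
    using assms by (auto simp: swp_apply)
  show "dual ?a (h D N) (h N D)"
    unfolding dual_def ND DN Q swp by (auto simp: ascent_def strict_def algebra_simps)
  show "dual ?a (h N D) (\<lambda>\<kappa>. (q - 1) * h N D \<kappa> + q * h D N \<kappa>)"
    unfolding dual_def ND DN Q swp by (auto simp: ascent_def strict_def algebra_simps)
qed

lemma depends_below_linear:
  assumes "depends_below b f" "depends_below b g"
  shows "depends_below b (\<lambda>\<kappa>. c * f \<kappa> + d * g \<kappa>)"
  unfolding depends_below_def
proof (intro allI impI)
  fix \<kappa> \<kappa>' :: "nat \<Rightarrow> nat"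
  assume "\<forall>x<b. \<kappa> x = \<kappa>' x"
  then have "f \<kappa> = f \<kappa>'" "g \<kappa> = g \<kappa>'"
    using assms unfolding depends_below_def by blast+
  then show "c * f \<kappa> + d * g \<kappa> = c * f \<kappa>' + d * g \<kappa>'"
    by simp
qed

lemma depends_below_wt:
  "max (fst (endpt w)) (snd (endpt w)) \<le> b \<Longrightarrow> depends_below (Suc b) (wt w 0 0)"
  unfolding depends_below_def by (auto intro!: wt_cong)

text \<open>The suffix relation is used for three dual pairs. For \<open>[N, N]\<close> the prefix
  weight is symmetric in the pair, hence dual to \<open>q\<close> times itself; the other two come
  from \<open>bottom_dual\<close>. The hypothesis \<open>U\<close> puts the cut between
  \<open>s\<close> and \<open>t\<close> at the height of the last bounce point.\<close>

lemma bounce_rel_bottom: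
  assumes good: "good n i j R R'" and ij: "i + 2 \<le> j"
    and A: "endpt (U @ [s, t] @ V) = (i, j)" and U: "snd (endpt (U @ [s])) = Suc i"
  shows "bounce_rel n U s t (V @ R) (V @ R')"
proof -
  have wsum: "wsum n M (U @ [s', t'] @ V @ X) =
      (\<Sum>\<kappa> \<in> cols n M. wt (U @ [s', t'] @ V) 0 0 \<kappa> * wt X i j \<kappa>)"
    if "endpt (U @ [s', t'] @ V) = (i, j)" for s' t' M X
    using wt_append[of "U @ [s', t'] @ V" X 0 0] that by (simp add: wsum_def)
  have dep: "depends_below (Suc j) (wt (U @ [s', t'] @ V) 0 0)"
    if "endpt (U @ [s', t'] @ V) = (i, j)" for s' t'
    using that ij by (intro depends_below_wt) simp
  note gd = good[unfolded good_def, rule_format]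
  show ?thesis
    unfolding bounce_rel_def
  proof (intro allI conjI impI)
    fix M
    assume st: "(s, t) = (N, N)"
    then have e: "endpt (U @ [N, N] @ V) = (i, j)"
      using A by simp
    have U': "fst (endpt U) \<le> i" "snd (endpt U) = i"
      using st A U by auto
    have "wt (U @ [N, N] @ V) 0 0 (swp (Suc i) \<kappa>) = wt (U @ [N, N] @ V) 0 0 \<kappa>" for \<kappa>
    proof -
      have "wt U 0 0 (swp (Suc i) \<kappa>) = wt U 0 0 \<kappa>"
        using U' by (intro wt_cong) (auto simp: swp_apply)
      moreover have "wt V (fst (endpt U)) (Suc (Suc i)) (swp (Suc i) \<kappa>) = wt V (fst (endpt U)) (Suc (Suc i)) \<kappa>"
        using e by (intro wt_swp) auto
      ultimately show ?thesis
        using U' by (simp add: wt_append)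
    qed
    then have "dual (Suc i) (wt (U @ [N, N] @ V) 0 0) (\<lambda>\<kappa>. q * wt (U @ [N, N] @ V) 0 0 \<kappa>)"
      unfolding dual_def by (simp add: algebra_simps)
    moreover have "depends_below (Suc j) (\<lambda>\<kappa>. q * wt (U @ [N, N] @ V) 0 0 \<kappa>)"
      using depends_below_linear[OF dep[OF e] dep[OF e], of q 0] by simp
    ultimately show "wsum n M (U @ [N, N] @ V @ R) = q * wsum n M (U @ [N, N] @ V @ R')"
      unfolding wsum[OF e] using gd[OF dep[OF e]] by (simp add: sum_distrib_left mult.assoc)
  next
    fix M
    assume st: "(s, t) = (D, N)"
    then have e: "endpt (U @ [N, D] @ V) = (i, j)" "endpt (U @ [D, N] @ V) = (i, j)"
      using A by auto
    have "endpt U = (fst (endpt U), i)"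
      using st U by (simp add: prod_eq_iff)
    then have "dual (Suc i) (wt (U @ [D, N] @ V) 0 0) (wt (U @ [N, D] @ V) 0 0)"
      by (rule bottom_dual) (use e in auto)
    then show "wsum n M (U @ [D, N] @ V @ R) = wsum n M (U @ [N, D] @ V @ R')"
      unfolding wsum[OF e(1)] wsum[OF e(2)] by (rule gd[OF dep[OF e(2)] dep[OF e(1)]])
  next
    fix M
    assume st: "(s, t) = (N, D)"
    then have e: "endpt (U @ [N, D] @ V) = (i, j)" "endpt (U @ [D, N] @ V) = (i, j)"
      using A by auto
    let ?h' = "\<lambda>\<kappa>. (q - 1) * wt (U @ [N, D] @ V) 0 0 \<kappa> + q * wt (U @ [D, N] @ V) 0 0 \<kappa>"
    have "endpt U = (fst (endpt U), i)"
      using st U by (simp add: prod_eq_iff)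
    then have "dual (Suc i) (wt (U @ [N, D] @ V) 0 0) ?h'"
      by (rule bottom_dual) (use e in auto)
    moreover have "depends_below (Suc j) ?h'"
      by (intro depends_below_linear dep e)
    ultimately show "wsum n M (U @ [N, D] @ V @ R) =
        (q - 1) * wsum n M (U @ [N, D] @ V @ R') + q * wsum n M (U @ [D, N] @ V @ R')"
      unfolding wsum[OF e(1)] wsum[OF e(2)] using gd[OF dep[OF e(1)]]
      by (simp add: sum_distrib_left distrib_right mult.assoc flip: sum.distrib)
  qed
qed

text \<open>While the induction descends along the chain, the suffix grows by
  \<open>[D, D] @ V\<close> at each bounce point. The cut at \<open>(i, j)\<close> lies one diagonal
  step before \<open>p\<close>, hence the shift to \<open>(Suc i, Suc j)\<close>. The inequality in
  the conclusion later keeps the word with \<open>[D, N]\<close> above the diagonal.\<close>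

lemma chain_bounce_rel:
  assumes "chain P p p'"
    and "P = U @ [s, t] @ Y" "endpt (U @ [s]) = p'" "t \<in> {N, D}"
    and "P = A @ R" "endpt A = (i, j)" "p = (Suc i, Suc j)" "i + 2 \<le> j" "j < n"
    and "good n i j R R'"
  shows "\<exists>V. A = U @ [s, t] @ V \<and> fst (endpt (U @ [s, t])) < snd (endpt (U @ [s])) \<and>
    bounce_rel n U s t (V @ R) (V @ R')"
  using assms
proof (induction arbitrary: A R R' i j rule: chain.induct)
  case (chain_stop u1 u0 u2)
  have "snd (endpt ((U @ [s]) @ [t])) = Suc (snd (endpt (U @ [s])))"
    unfolding endpt_append[of "U @ [s]" "[t]"] using chain_stop(3) by auto
  then have "A @ R = (U @ [s]) @ [t] @ Y" "snd (endpt ((U @ [s]) @ [t])) \<le> snd (endpt A)"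
    using chain_stop by simp_all
  with chain_stop(3) obtain V where V: "A = (U @ [s]) @ [t] @ V"
    using prefix_by_height by blast
  then have "bounce_rel n U s t (V @ R) (V @ R')"
    using chain_stop by (intro bounce_rel_bottom[where i = i and j = j]) auto
  moreover have "fst (endpt (U @ [s, t])) < snd (endpt (U @ [s]))"
    using V chain_stop endpt_append[of "U @ [s, t]" V] by simp
  ultimately show ?case
    using V by auto
next
  case (chain_on u2 u1 p' u0)
  from chain_on(1) obtain B C where P: "P = B @ [D] @ [D] @ C" and B: "endpt (B @ [D]) = (u2, u1)"
    by (auto simp: between_diagonals_def)
  have u1: "u1 = Suc i"
    using chain_on.prems by simp
  have "A @ R = (B @ [D]) @ [D] @ C" "snd (endpt ((B @ [D]) @ [D])) \<le> snd (endpt A)"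
    using P B u1 chain_on.prems by auto
  then obtain V where V: "A = (B @ [D]) @ [D] @ V"
    using prefix_by_height[of A R "B @ [D]" D C] by auto
  define i2 where "i2 = fst (endpt B)"
  have eB: "endpt B = (i2, i)" and u2: "u2 = Suc i2"
    using B u1 by (auto simp: i2_def prod_eq_iff)
  have eV: "endpt V = (i - i2 - 2, j - i - 2)" and i2: "i2 + 2 \<le> i"
    using V eB chain_on.prems by (auto simp: prod_eq_iff)
  have "good n i2 i ([D, D] @ V @ R) ([D, D] @ V @ R')"
    using chain_on.prems i2 eV by (intro good_step) auto
  then obtain V' where "B = U @ [s, t] @ V'" "fst (endpt (U @ [s, t])) < snd (endpt (U @ [s]))"
    "bounce_rel n U s t (V' @ [D, D] @ V @ R) (V' @ [D, D] @ V @ R')"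
    using chain_on.IH[of B "[D, D] @ V @ R" i2 i "[D, D] @ V @ R'"] chain_on.prems eB u1 u2 i2 V P
    by auto
  then show ?case
    using V by (intro exI[of _ "V' @ [D, D] @ V"]) auto
qed

text \<open>Membership in \<open>SCH\<close> comes along since \<open>coeff_LLT\<close> requires it
  and the proof of symmetry recurses on the rewritten paths. The weaker \<open>chain\<close>
  suffices as hypothesis, so that proof need not follow a bounce path exactly.\<close>

lemma LLT_bounce:
  assumes P: "P \<in> SCH" "P = U @ [s, t] @ V @ [D, E] @ W"
    and chain: "chain P (x, z) (endpt (U @ [s]))"
    and xz: "endpt (U @ [s, t] @ V @ [D]) = (x, z)" "x + 1 < z" and t: "t \<in> {N, D}"
  shows "(s, t) = (N, N) \<Longrightarrow> U @ [N, N] @ V @ [E, D] @ W \<in> SCH \<and>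
      LLT P = scale_mps q (LLT (U @ [N, N] @ V @ [E, D] @ W))"
    and "(s, t) = (D, N) \<Longrightarrow> U @ [N, D] @ V @ [E, D] @ W \<in> SCH \<and>
      LLT P = LLT (U @ [N, D] @ V @ [E, D] @ W)"
    and "(s, t) = (N, D) \<Longrightarrow> U @ [N, D] @ V @ [E, D] @ W \<in> SCH \<and> U @ [D, N] @ V @ [E, D] @ W \<in> SCH \<and>
      LLT P = scale_mps (q - 1) (LLT (U @ [N, D] @ V @ [E, D] @ W)) +
        scale_mps q (LLT (U @ [D, N] @ V @ [E, D] @ W))"
proof -
  let ?A = "U @ [s, t] @ V" and ?n = "psize P"
  obtain i j where A: "endpt ?A = (i, j)"
    by fastforce
  have "endpt (?A @ [D]) = (Suc i, Suc j)"
    unfolding endpt_append[of ?A "[D]"] A by simp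
  with xz(1) have x: "x = Suc i" "z = Suc j"
    by simp_all
  have eP: "endpt P = (?n, ?n)"
    using P(1) by (rule endpt_SCH)
  have "P = ?A @ [D, E] @ W"
    using P(2) by simp
  then have "endpt P = (i + (2 + fst (endpt W)), j + (1 + snd (endpt W)))"
    using endpt_append[of ?A "[D, E] @ W"] A by simp
  then have eW: "endpt W = (?n - i - 2, ?n - j - 1)" "j < ?n"
    using eP by (auto simp: prod_eq_iff)
  have ij: "i + 2 \<le> j"
    using x xz by simp
  have "good ?n i j (D # E # W) (E # D # W)"
    using ij eW by (intro good_top) auto
  then obtain V' where V': "?A = U @ [s, t] @ V'"
    and lt: "fst (endpt (U @ [s, t])) < snd (endpt (U @ [s]))"
    and rel: "bounce_rel ?n U s t (V' @ D # E # W) (V' @ E # D # W)"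
    using chain_bounce_rel[OF chain, of U s t "V @ [D, E] @ W" ?A "D # E # W" i j ?n "E # D # W"]
      P(2) t A x ij eW by auto
  have V: "V' = V"
    using V' by simp
  note rel = rel[unfolded V bounce_rel_def, rule_format]
  have coeff: "coeff_mps (LLT Y) M = wsum ?n M Y" if "Y \<in> SCH" "psize Y = ?n" for Y M
    using coeff_LLT[OF that(1)] that(2) by (simp add: wsum_def)
  \<comment> \<open>At excess 2 a diagonal step is still allowed after the east step of
    \<open>[E, D]\<close>.\<close>
  have excess: "excess ?A \<ge> 2"
    using A ij by (simp add: excess_def)
  note above = P(1)[unfolded P(2) SCH_iff]
  show "U @ [N, N] @ V @ [E, D] @ W \<in> SCH \<and>
      LLT P = scale_mps q (LLT (U @ [N, N] @ V @ [E, D] @ W))" if st: "(s, t) = (N, N)"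
  proof (rule conjI)
    show SCH: "U @ [N, N] @ V @ [E, D] @ W \<in> SCH"
      using above excess st by (simp add: SCH_iff algebra_simps)
    show "LLT P = scale_mps q (LLT (U @ [N, N] @ V @ [E, D] @ W))"
    proof (rule mps_eqI)
      fix M
      have "psize (U @ [N, N] @ V @ [E, D] @ W) = ?n"
        using P(2) st by simp
      then show "coeff_mps (LLT P) M = coeff_mps (scale_mps q (LLT (U @ [N, N] @ V @ [E, D] @ W))) M"
        using coeff[OF SCH] coeff[OF P(1)] rel[of M] st P(2) by simp
    qed
  qed
  show "U @ [N, D] @ V @ [E, D] @ W \<in> SCH \<and>
      LLT P = LLT (U @ [N, D] @ V @ [E, D] @ W)" if st: "(s, t) = (D, N)"
  proof (rule conjI)
    show SCH: "U @ [N, D] @ V @ [E, D] @ W \<in> SCH"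
      using above excess st by (simp add: SCH_iff algebra_simps)
    show "LLT P = LLT (U @ [N, D] @ V @ [E, D] @ W)"
    proof (rule mps_eqI)
      fix M
      have "psize (U @ [N, D] @ V @ [E, D] @ W) = ?n"
        using P(2) st by simp
      then show "coeff_mps (LLT P) M = coeff_mps (LLT (U @ [N, D] @ V @ [E, D] @ W)) M"
        using coeff[OF SCH] coeff[OF P(1)] rel[of M] st P(2) by simp
    qed
  qed
  show "U @ [N, D] @ V @ [E, D] @ W \<in> SCH \<and> U @ [D, N] @ V @ [E, D] @ W \<in> SCH \<and>
      LLT P = scale_mps (q - 1) (LLT (U @ [N, D] @ V @ [E, D] @ W)) +
        scale_mps q (LLT (U @ [D, N] @ V @ [E, D] @ W))" if st: "(s, t) = (N, D)"
  proof (intro conjI)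
    show SCH1: "U @ [N, D] @ V @ [E, D] @ W \<in> SCH"
      using above excess st by (simp add: SCH_iff algebra_simps)
    have "excess U > 0"
      using lt st by (simp add: excess_def)
    then show SCH2: "U @ [D, N] @ V @ [E, D] @ W \<in> SCH"
      using above excess st by (simp add: SCH_iff algebra_simps)
    show "LLT P = scale_mps (q - 1) (LLT (U @ [N, D] @ V @ [E, D] @ W)) +
        scale_mps q (LLT (U @ [D, N] @ V @ [E, D] @ W))"
    proof (rule mps_eqI)
      fix M
      have "psize (U @ [N, D] @ V @ [E, D] @ W) = ?n" "psize (U @ [D, N] @ V @ [E, D] @ W) = ?n"
        using P(2) st by simp_all
      then show "coeff_mps (LLT P) M = coeff_mps (scale_mps (q - 1) (LLT (U @ [N, D] @ V @ [E, D] @ W)) +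
          scale_mps q (LLT (U @ [D, N] @ V @ [E, D] @ W))) M"
        using coeff[OF SCH1] coeff[OF SCH2] coeff[OF P(1)] rel[of M] st P(2) by simp
    qed
  qed
qed

section \<open>Symmetry\<close>

lemma Lambda_I:
  assumes "\<And>M. coeff_mps f M \<noteq> 0 \<Longrightarrow> set_mset M \<subseteq> {0<..} \<and> size M \<le> d"
    and "\<And>\<sigma> M. \<sigma> permutes {0<..} \<Longrightarrow> coeff_mps f (image_mset \<sigma> M) = coeff_mps f M"
  shows "f \<in> Lambda"
  using assms unfolding Lambda_def by blast

lemma Lambda_linear:
  assumes "f \<in> Lambda" "g \<in> Lambda"
  shows "scale_mps c f + scale_mps d g \<in> Lambda"
proof -
  obtain d1 d2 where "\<forall>M. coeff_mps f M \<noteq> 0 \<longrightarrow> size M \<le> d1" "\<forall>M. coeff_mps g M \<noteq> 0 \<longrightarrow> size M \<le> d2"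
    using assms unfolding Lambda_def by blast
  then have size: "size M \<le> max d1 d2" if "coeff_mps f M \<noteq> 0 \<or> coeff_mps g M \<noteq> 0" for M
    using that by (meson max.coboundedI1 max.coboundedI2)
  show ?thesis
  proof (rule Lambda_I)
    fix M
    assume "coeff_mps (scale_mps c f + scale_mps d g) M \<noteq> 0"
    then have "coeff_mps f M \<noteq> 0 \<or> coeff_mps g M \<noteq> 0"
      by auto
    then show "set_mset M \<subseteq> {0<..} \<and> size M \<le> max d1 d2"
      using size assms unfolding Lambda_def by blast
  qed (use assms in \<open>simp add: Lambda_def\<close>)
qed

lemma scale_mps_0 [simp]: "scale_mps 0 f = 0"
  by (rule mps_eqI) (simp add: zero_mps_def)

lemma scale_mps_1 [simp]: "scale_mps 1 f = f"
  by (rule mps_eqI) simp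

lemma Lambda_scale: "f \<in> Lambda \<Longrightarrow> scale_mps c f \<in> Lambda"
  using Lambda_linear[of f f c 0] by simp

lemma Lambda_mult:
  assumes f: "f \<in> Lambda" and g: "g \<in> Lambda"
  shows "f * g \<in> Lambda"
proof -
  obtain d1 d2 where d: "\<And>M. coeff_mps f M \<noteq> 0 \<Longrightarrow> size M \<le> d1" "\<And>M. coeff_mps g M \<noteq> 0 \<Longrightarrow> size M \<le> d2"
    using assms unfolding Lambda_def by blast
  have coeff: "coeff_mps (f * g) M = (\<Sum>(A, B) \<in> {(A, B). A + B = M}. coeff_mps f A * coeff_mps g B)" for M
    by (simp add: times_mps_def)
  show ?thesis
  proof (rule Lambda_I)
    fix M
    assume "coeff_mps (f * g) M \<noteq> 0"
    then obtain p where "p \<in> {(A, B). A + B = M}" "(case p of (A, B) \<Rightarrow> coeff_mps f A * coeff_mps g B) \<noteq> 0"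
      unfolding coeff by (rule sum.not_neutral_contains_not_neutral)
    then obtain A B where AB: "A + B = M" "coeff_mps f A \<noteq> 0" "coeff_mps g B \<noteq> 0"
      by (cases p) auto
    then have "set_mset A \<subseteq> {0<..}" "set_mset B \<subseteq> {0<..}"
      using f g unfolding Lambda_def by blast+
    with d(1)[OF AB(2)] d(2)[OF AB(3)] AB(1) show "set_mset M \<subseteq> {0<..} \<and> size M \<le> d1 + d2"
      by auto
  next
    fix \<sigma> :: "nat \<Rightarrow> nat" and M
    assume \<sigma>: "\<sigma> permutes {0<..}"
    have inv: "image_mset (inv \<sigma>) (image_mset \<sigma> X) = X" "image_mset \<sigma> (image_mset (inv \<sigma>) X) = X" for X
      using permutes_inv_o[OF \<sigma>] by (simp_all add: image_mset.compositionality)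
    have sym: "coeff_mps h (image_mset (inv \<sigma>) X) = coeff_mps h X" if "h \<in> Lambda" for h X
      using that permutes_inv[OF \<sigma>] unfolding Lambda_def by blast
    show "coeff_mps (f * g) (image_mset \<sigma> M) = coeff_mps (f * g) M"
      unfolding coeff
      by (rule sum.reindex_bij_witness[of _ "map_prod (image_mset \<sigma>) (image_mset \<sigma>)"
            "map_prod (image_mset (inv \<sigma>)) (image_mset (inv \<sigma>))"])
        (auto simp: inv sym[OF f] sym[OF g] simp flip: image_mset_union)
  qed
qed

lemma elem_sym_Lambda: "elem_sym k \<in> Lambda"
proof (rule Lambda_I)
  fix M
  assume "coeff_mps (elem_sym k) M \<noteq> 0"
  then show "set_mset M \<subseteq> {0<..} \<and> size M \<le> k"
    by (auto simp: elem_sym_def split: if_splits)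
next
  fix \<sigma> :: "nat \<Rightarrow> nat" and M
  assume \<sigma>: "\<sigma> permutes {0<..}"
  let ?P = "\<lambda>M. \<exists>S. S \<subseteq> {0<..} \<and> finite S \<and> card S = k \<and> M = mset_set S"
  have "?P (image_mset \<tau> M)" if "?P M" and \<tau>: "\<tau> permutes {0<..}" for M and \<tau> :: "nat \<Rightarrow> nat"
  proof -
    from \<open>?P M\<close> obtain S where S: "S \<subseteq> {0<..}" "finite S" "card S = k" "M = mset_set S"
      by blast
    have inj: "inj_on \<tau> S"
      using permutes_inj_on[OF \<tau>] .
    show ?thesis
      using S inj permutes_image[OF \<tau>]
      by (intro exI[of _ "\<tau> ` S"]) (auto simp: card_image image_mset_mset_set)
  qed
  note this[OF _ \<sigma>] this[OF _ permutes_inv[OF \<sigma>], of "image_mset \<sigma> M"]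
  moreover have "image_mset (inv \<sigma>) (image_mset \<sigma> M) = M"
    using permutes_inv_o[OF \<sigma>] by (simp add: image_mset.compositionality)
  ultimately have "?P (image_mset \<sigma> M) \<longleftrightarrow> ?P M"
    by auto
  then show "coeff_mps (elem_sym k) (image_mset \<sigma> M) = coeff_mps (elem_sym k) M"
    by (simp add: elem_sym_def)
qed

section \<open>Reduction at the first east step\<close>

lemma LLT_Nil: "LLT [] = elem_sym 0"
proof (rule mps_eqI)
  fix M
  have "[] \<in> SCH"
    by (simp add: SCH_iff)
  then show "coeff_mps (LLT []) M = coeff_mps (elem_sym 0) M"
    by (simp add: coeff_LLT flip: sum_increasing_cols)
qed

text \<open>A step raises the height by at most one, so no height is skipped.\<close>

lemma prefix_with_height:
  "k \<le> snd (endpt A) \<Longrightarrow> \<exists>X Y. A = X @ Y \<and> snd (endpt X) = k"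
proof (induction A arbitrary: k)
  case (Cons s A)
  show ?case
  proof (cases "k = 0")
    case True
    show ?thesis
      by (rule exI[of _ "[]"]) (simp add: True)
  next
    case False
    define k' where "k' = (if s = E then k else k - 1)"
    have "k' \<le> snd (endpt A)"
      using Cons.prems by (cases s) (auto simp: k'_def)
    then obtain X Y where "A = X @ Y" "snd (endpt X) = k'"
      using Cons.IH by blast
    then show ?thesis
      using False by (intro exI[of _ "s # X"] exI[of _ Y]) (cases s; simp add: k'_def)
  qed
qed simp

text \<open>Cutting \<open>A\<close> at height \<open>i + 1\<close> imitates the westward move of
  the bounce path. The steps at the cut are not east: they form one of the three bottoms, or
  \<open>[D, D]\<close>, and then the search goes on in the shorter prefix \<open>U\<close>. These
  two diagonal steps use up two columns, which restores \<open>i2 + 2 \<le> i\<close>.\<close>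

lemma chain_exists:
  assumes "E \<notin> set A" "P = A @ R" "endpt A = (i, j)" "i + 2 \<le> j"
  shows "\<exists>U s t V. A = U @ [s, t] @ V \<and> (s, t) \<in> {(N, N), (D, N), (N, D)} \<and>
    chain P (Suc i, Suc j) (endpt (U @ [s]))"
  using assms
proof (induction "length A" arbitrary: A R i j rule: less_induct)
  case less
  obtain X Y where XY: "A = X @ Y" "snd (endpt X) = Suc i"
    using prefix_with_height[of "Suc i" A] less.prems by auto
  have "X \<noteq> []"
    using XY by auto
  then obtain U s where X: "X = U @ [s]"
    by (metis rev_exhaust)
  have "Y \<noteq> []"
    using XY less.prems by auto
  then obtain t V where Y: "Y = t # V"
    by (metis neq_Nil_conv)
  have A: "A = U @ [s, t] @ V"
    using XY X Y by simp
  then have st: "s \<noteq> E" "t \<noteq> E"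
    using less.prems by auto
  show ?case
  proof (cases "(s, t) = (D, D)")
    case False
    moreover have "chain P (Suc i, Suc j) (endpt (U @ [s]))"
      using XY X chain_stop[of P "Suc i" "Suc j" "fst (endpt X)"] by (simp add: prod_eq_iff)
    ultimately show ?thesis
      using A st by (intro exI[of _ U] exI[of _ s] exI[of _ t] exI[of _ V]) (cases s; cases t; auto)
  next
    case True
    obtain i2 where U: "endpt U = (i2, i)"
      using XY X True by (auto simp: prod_eq_iff)
    have "i2 + 2 \<le> i"
      using less.prems A U True by auto
    with less.hyps[of U "[s, t] @ V @ R" i2 i] obtain U' s' t' V'
      where IH: "U = U' @ [s', t'] @ V'" "(s', t') \<in> {(N, N), (D, N), (N, D)}"
        "chain P (Suc i2, Suc i) (endpt (U' @ [s']))"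
      using less.prems A U by auto
    have "between_diagonals P (Suc i2, Suc i)"
      unfolding between_diagonals_def using less.prems A U True
      by (intro exI[of _ U] exI[of _ "V @ R"]) simp
    then have "chain P (Suc i, Suc j) (endpt (U' @ [s']))"
      using IH(3) by (rule chain_on)
    then show ?thesis
      using IH A by (intro exI[of _ U'] exI[of _ s'] exI[of _ t'] exI[of _ "V' @ [s, t] @ V"]) auto
  qed
qed

lemma takeWhile_first_E: "E \<notin> set X \<Longrightarrow> takeWhile (\<lambda>s. s \<noteq> E) (X @ E # Y) = X"
  by (induction X) auto

lemma count_list_zero_iff: "count_list xs x = 0 \<longleftrightarrow> x \<notin> set xs"
  by (induction xs) auto

lemma replicate_D_if: "N \<notin> set A \<Longrightarrow> E \<notin> set A \<Longrightarrow> A = replicate (length A) D"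
proof (induction A)
  case (Cons s A)
  then show ?case
    by (cases s) auto
qed simp

lemma starts_with_N_Ds:
  assumes "stays_above 0 (A @ E # W)" "E \<notin> set A" "count_list A N \<le> 1"
  obtains k where "A = N # replicate k D"
proof (cases A)
  case Nil
  with assms show ?thesis by simp
next
  case (Cons s B)
  with assms have s: "s = N"
    by (cases s) auto
  with Cons assms have "N \<notin> set B" "E \<notin> set B"
    by (auto simp: count_list_zero_iff)
  then show ?thesis
    using that[of "length B"] Cons s replicate_D_if[of B] by simp
qed

text \<open>The measure compares the number of east steps and then the number of steps before the
  first one. If at least two north steps precede it, the step just before it decides:
  \<open>N\<close> calls for the corner relation and \<open>D\<close> for a bounce relation.\<close>

lemma LLT_Lambda: "P \<in> SCH \<Longrightarrow> LLT P \<in> Lambda"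
proof (induction P rule: wf_induct_rule[OF wf_measures,
      of "[\<lambda>P. count_list P E, \<lambda>P. length (takeWhile (\<lambda>s. s \<noteq> E) P)]"])
  case (1 P)
  note IH = 1(1) and P = 1(2)
  show ?case
  proof (cases "E \<in> set P")
    case False
    then have "count_list P N = 0"
      using P by (simp add: SCH_iff excess_count count_list_zero_iff)
    then have "N \<notin> set P"
      by (simp add: count_list_zero_iff)
    then obtain k where k: "P = replicate k D"
      using replicate_D_if False by blast
    moreover have "stays_above 0 P"
      using P by (simp add: SCH_iff)
    ultimately have "P = []"
      unfolding k by (cases k) auto
    then show ?thesis
      by (simp add: LLT_Nil elem_sym_Lambda)
  next
    case True
    then obtain A W where PA: "P = A @ E # W" and A: "E \<notin> set A"
      by (meson split_list_first)
    have above: "stays_above 0 (A @ E # W)" "excess (A @ E # W) = 0"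
      using P PA by (auto simp: SCH_iff)
    have smaller: "LLT Y \<in> Lambda" if "Y = X @ E # Z" "Y \<in> SCH" "E \<notin> set X"
      "count_list Y E = count_list P E" "length X < length A" for X Y Z
      using that A PA by (intro IH) (simp_all add: takeWhile_first_E)
    have fewer: "LLT Y \<in> Lambda" if "Y \<in> SCH" "count_list Y E < count_list P E" for Y
      using that by (intro IH) simp_all
    show ?thesis
    proof (cases "count_list A N \<le> 1")
      case True
      then obtain k where k: "A = N # replicate k D"
        using starts_with_N_Ds above A by blast
      have W: "W \<in> SCH"
        using above k by (simp add: SCH_iff)
      have "P = ([N] @ replicate k D @ [E]) @ W"
        using PA k by simp
      then have "LLT P = elem_sym (k + 1) * LLT W"
        using LLT_append[OF N_Ds_E_SCH W, of k] LLT_N_Ds_E[of k] by simp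
      moreover have "LLT W \<in> Lambda"
        using W PA by (intro fewer) auto
      ultimately show ?thesis
        by (simp add: Lambda_mult elem_sym_Lambda)
    next
      case False
      \<comment> \<open>Without east steps the excess is the number of north steps.\<close>
      then have ex: "excess A \<ge> 2"
        using A by (simp add: excess_count count_list_zero_iff)
      then have "A \<noteq> []"
        by auto
      then obtain B s where B: "A = B @ [s]"
        by (metis rev_exhaust)
      then consider "s = N" | "s = D"
        using A by (cases s) auto
      then show ?thesis
      proof cases
        case 1
        then have "B @ [D] @ W \<in> SCH"
          using above ex B by (simp add: SCH_iff)
        note corner_SCH(2)[OF this] LLT_corner[OF this] this
        moreover have "LLT (B @ [E, N] @ W) \<in> Lambda"
          using calculation(1) PA B 1 A by (intro smaller[of _ B "N # W"]) auto
        moreover have "LLT (B @ [D] @ W) \<in> Lambda"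
          using calculation(3) PA B 1 by (intro fewer) auto
        moreover have "LLT P = scale_mps 1 (LLT (B @ [E, N] @ W)) + scale_mps (q - 1) (LLT (B @ [D] @ W))"
          using calculation(2) PA B 1 by (simp add: algebra_simps)
        ultimately show ?thesis
          by (simp only: Lambda_linear)
      next
        case 2
        obtain i j where e: "endpt B = (i, j)"
          by fastforce
        have ij: "i + 2 \<le> j"
          using ex B 2 e by (simp add: excess_def)
        obtain U s' t V where U: "B = U @ [s', t] @ V" "(s', t) \<in> {(N, N), (D, N), (N, D)}"
          "chain P (Suc i, Suc j) (endpt (U @ [s']))"
          using chain_exists[of B P "[D, E] @ W" i j] PA B 2 A e ij by auto
        have PU: "P = U @ [s', t] @ V @ [D, E] @ W"
          using PA B U 2 by simp
        have "endpt (B @ [D]) = (Suc i, Suc j)"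
          unfolding endpt_append[of B] e by simp
        then have eU: "endpt (U @ [s', t] @ V @ [D]) = (Suc i, Suc j)"
          using U(1) by simp
        note rel = LLT_bounce[OF P PU U(3) eU]
        have E: "E \<notin> set U" "E \<notin> set V"
          using A B U by auto
        have len: "length A = length U + length V + 3"
          using B U by simp
        have cnt: "count_list P E = count_list W E + 1"
          using PA A by (simp add: count_list_zero_iff[THEN iffD2])
        \<comment> \<open>With \<open>[E, D]\<close> in place of \<open>[D, E]\<close> the first
          east step stands one place further left.\<close>
        have small: "LLT (U @ [a, b] @ V @ [E, D] @ W) \<in> Lambda"
          if "U @ [a, b] @ V @ [E, D] @ W \<in> SCH" "a \<noteq> E" "b \<noteq> E" for a b
          using that E len cnt
          by (intro smaller[of _ "U @ [a, b] @ V" "D # W"]) (auto simp: count_list_zero_iff[THEN iffD2])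
        from U(2) consider "(s', t) = (N, N)" | "(s', t) = (D, N)" | "(s', t) = (N, D)"
          by auto
        then show ?thesis
        proof cases
          case 1
          with rel(1) ij small[of N N] show ?thesis
            by (auto intro: Lambda_scale)
        next
          case 2
          with rel(2) ij small[of N D] show ?thesis
            by auto
        next
          case 3
          with rel(3) ij small[of N D] small[of D N] show ?thesis
            by (auto intro: Lambda_linear)
        qed
      qed
    qed
  qed
qed

text \<open>\<open>F\<close> is prescribed on paths only, so each value on a rewritten word rests on
  the membership in \<open>SCH\<close> established with the relation.\<close>

theorem theorem2p5:
  fixes F :: "step list \<Rightarrow> K mps"
  assumes F_def: "\<And>P. P \<in> SCH \<Longrightarrow> F P = LLT P"
  shows "F ` SCH \<subseteq> Lambda
    \<and> (\<forall>k. F ([N] @ replicate k D @ [E]) = elem_sym (k + 1))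
    \<and> (\<forall>P \<in> SCH. \<forall>Q \<in> SCH. F (P @ Q) = F P * F Q)
    \<and> (\<forall>U V. U @ [D] @ V \<in> SCH \<longrightarrow>
          F (U @ [N, E] @ V) - F (U @ [E, N] @ V) = scale_mps (q - 1) (F (U @ [D] @ V)))
    \<and> (\<forall>P \<in> SCH. \<forall>x z U s t V W.
          on_path P (x, z) \<and> x + 1 < z \<and> bounce_decomp P (x, z) U s t V D E W \<longrightarrow>
            ((s, t) = (N, N) \<longrightarrow> F P = scale_mps q (F (U @ [N, N] @ V @ [E, D] @ W)))
          \<and> ((s, t) = (D, N) \<longrightarrow> F P = F (U @ [N, D] @ V @ [E, D] @ W))
          \<and> ((s, t) = (N, D) \<longrightarrow>
               F P = scale_mps (q - 1) (F (U @ [N, D] @ V @ [E, D] @ W))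
                   + scale_mps q (F (U @ [D, N] @ V @ [E, D] @ W))))"
proof (intro conjI allI ballI impI)
  show "F ` SCH \<subseteq> Lambda"
    using F_def LLT_Lambda by auto
  show "F ([N] @ replicate k D @ [E]) = elem_sym (k + 1)" for k
    using F_def[OF N_Ds_E_SCH] LLT_N_Ds_E by simp
  show "F (P @ Q) = F P * F Q" if "P \<in> SCH" "Q \<in> SCH" for P Q
    using that by (simp add: F_def SCH_append LLT_append)
  show "F (U @ [N, E] @ V) - F (U @ [E, N] @ V) = scale_mps (q - 1) (F (U @ [D] @ V))"
    if "U @ [D] @ V \<in> SCH" for U V
    unfolding F_def[OF that] F_def[OF corner_SCH(1)[OF that]] F_def[OF corner_SCH(2)[OF that]]
    by (rule LLT_corner[OF that])
next
  fix P x z U s t V W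
  assume P: "P \<in> SCH" and "on_path P (x, z) \<and> x + 1 < z \<and> bounce_decomp P (x, z) U s t V D E W"
  then have xz: "x + 1 < z" and decomp: "bounce_decomp P (x, z) U s t V D E W"
    by blast+
  note decomp = decomp[unfolded bounce_decomp_def append.simps]
  have PU: "P = U @ [s, t] @ V @ [D, E] @ W"
    unfolding append.simps by (rule conjunct1[OF decomp])
  have e: "endpt (U @ [s, t] @ V @ [D]) = (x, z)"
    unfolding append.simps by (rule conjunct1[OF conjunct2[OF decomp]])
  have "bounce P (x, z) (endpt (U @ [s]))"
    by (rule conjunct2[OF conjunct2[OF decomp]])
  then have "chain P (x, z) (endpt (U @ [s]))"
    by (intro bounce_chain)
  note rel = LLT_bounce[OF P PU this e xz]
  show "F P = scale_mps q (F (U @ [N, N] @ V @ [E, D] @ W))" if "(s, t) = (N, N)"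
    using rel(1)[OF _ that] F_def[OF P] F_def that by auto
  show "F P = F (U @ [N, D] @ V @ [E, D] @ W)" if "(s, t) = (D, N)"
    using rel(2)[OF _ that] F_def[OF P] F_def that by auto
  show "F P = scale_mps (q - 1) (F (U @ [N, D] @ V @ [E, D] @ W))
      + scale_mps q (F (U @ [D, N] @ V @ [E, D] @ W))" if "(s, t) = (N, D)"
    using rel(3)[OF _ that] F_def[OF P] F_def that by auto
qed

end
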